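(* Let $X_1,X_2,\dots$ be i.i.d. with law $P$, a probability distribution on $[0,1]$ with mean $m$ and variance $\sigma^2>0$. Let the GRAPA bet fraction be $$\lambda_n^{\mathsf{GRAPA}}\in\operatorname*{arg\,max}_{\lambda\in[-\frac1{1-m},\frac1m]}\ \frac{1}{n-1}\sum_{k=1}^{n-1}\log\bigl(1+\lambda(X_k-m)\bigr).$$ Then it satisfies the almost sure Bahadur expansion $$\sqrt n\,\lambda_{n+1}^{\mathsf{GRAPA}}=\frac1{\sigma^2}\cdot\frac{\sum_{k=1}^n(X_k-m)}{\sqrt n}+o_{a.s.}(n^{-1/4}\log n),$$ and hence $\sqrt n\,\lambda_{n+1}^{\mathsf{GRAPA}}\to\mathcal N(0,\sigma^{-2})$ weakly. Therefore $\lambda_n^{\mathsf{GRAPA}}=\Omega_p(n^{-1/2})$, and consequently the GRAPA wealth process $\prod_{k=1}^n\bigl(1+\lambda_k^{\mathsf{GRAPA}}(X_k-m)\bigr)$ converges to $0$ almost surely as $n\to\infty$.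
   Context: Convention $\log 0=-\infty$. Where the maximizer is not unique (only when $n=1$ or $X_1=\dots=X_{n-1}=m$), $\lambda_n^{\mathsf{GRAPA}}$ is any $\sigma(X_1,\dots,X_{n-1})$-measurable choice in $[-\frac1{1-m},\frac1m]$. For random variables $(Y_n)$ and positive nonrandom $(a_n)$: $Y_n=o_{a.s.}(a_n)$ means $Y_n/a_n\to0$ with probability one; $Y_n=\Omega_p(a_n)$ means that for every $\varepsilon>0$ there is $\delta>0$ with $\mathbb P(|Y_n|\ge\delta a_n)\ge1-\varepsilon$ for all but finitely many $n$. *)

theory Defs
  imports "HOL-Probability.Probability"
begin

(* Extended-real logarithm with log 0 = -\<infinity> (the real ln of HOL has ln 0 = 0).
   Negative arguments also get -\<infinity>; they only arise on the null event where some
   observation lies outside [0,1]. *)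
definition elog :: "real \<Rightarrow> ereal" where
  "elog x = (if 0 < x then ereal (ln x) else -\<infinity>)"

(* The \<sigma>-algebra on the sample space generated by the real variables X i, i \<in> I;
   it is trivial for I = {}. *)
definition sigma_gen_by :: "'a measure \<Rightarrow> (nat \<Rightarrow> 'a \<Rightarrow> real) \<Rightarrow> nat set \<Rightarrow> 'a measure" where
  "sigma_gen_by M X I =
     sigma (space M) (\<Union>i\<in>I. {X i -` A \<inter> space M | A. A \<in> sets borel})"

definition grapa_objective :: "(nat \<Rightarrow> 'a \<Rightarrow> real) \<Rightarrow> real \<Rightarrow> nat \<Rightarrow> 'a \<Rightarrow> real \<Rightarrow> ereal" where
  "grapa_objective X m n \<omega> l =
     ereal (1 / real (n - 1)) * (\<Sum>k = 1..n - 1. elog (1 + l * (X k \<omega> - m)))"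

(* lam n is a version of the n-th GRAPA bet: a maximiser over [-1/(1-m), 1/m], chosen
   measurably from the first n - 1 observations.  For n = 1 the objective is 0 (empty sum),
   so lam 1 is any constant of the interval.  The measurability only restricts the choice
   where the maximiser is not unique; elsewhere it is, up to null sets, a Borel function of the
   observations. *)
definition is_grapa :: "'a measure \<Rightarrow> (nat \<Rightarrow> 'a \<Rightarrow> real) \<Rightarrow> real \<Rightarrow> (nat \<Rightarrow> 'a \<Rightarrow> real) \<Rightarrow> bool" where
  "is_grapa M X m lam \<longleftrightarrow>
     (\<forall>n\<ge>1. lam n \<in> borel_measurable (sigma_gen_by M X {1..n - 1}) \<and>
       (AE \<omega> in M. is_arg_max (grapa_objective X m n \<omega>)
                      (\<lambda>l. l \<in> {- 1 / (1 - m)..1 / m}) (lam n \<omega>)))"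

definition little_o_as :: "'a measure \<Rightarrow> (nat \<Rightarrow> 'a \<Rightarrow> real) \<Rightarrow> (nat \<Rightarrow> real) \<Rightarrow> bool" where
  "little_o_as M Y a \<longleftrightarrow> (AE \<omega> in M. (\<lambda>n. Y n \<omega> / a n) \<longlonglongrightarrow> 0)"

definition big_Omega_p :: "'a measure \<Rightarrow> (nat \<Rightarrow> 'a \<Rightarrow> real) \<Rightarrow> (nat \<Rightarrow> real) \<Rightarrow> bool" where
  "big_Omega_p M Y a \<longleftrightarrow>
     (\<forall>\<epsilon>>0. \<exists>\<delta>>0. \<forall>\<^sub>F n in sequentially.
        measure M {\<omega> \<in> space M. \<bar>Y n \<omega>\<bar> \<ge> \<delta> * a n} \<ge> 1 - \<epsilon>)"

end

theory Submission
  imports Defs "HOL-Real_Asymp.Real_Asymp"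
begin

text \<open>
  With \<open>Y\<^sub>k = X\<^sub>k - m\<close>, \<open>S\<^sub>n = \<Sum>k\<le>n. Y\<^sub>k\<close> and \<open>V\<^sub>n = \<Sum>k\<le>n. Y\<^sub>k\<^sup>2\<close>, the bound
  \<open>ln (1 + x) \<le> x - \<kappa> x\<^sup>2\<close> on \<open>(-1, B]\<close> and the fact that the maximiser \<open>\<lambda>\<close> does at least as
  well as \<open>0\<close> give \<open>\<kappa> \<lambda>\<^sup>2 V\<^sub>n \<le> \<lambda> S\<^sub>n\<close>.  Hoeffding and Borel-Cantelli bound \<open>S\<^sub>n\<close> and
  \<open>V\<^sub>n - n \<sigma>\<^sup>2\<close> by \<open>sqrt (n ln n)\<close>, so \<open>\<lambda> = O (sqrt (ln n / n))\<close> is eventually interior, and expanding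
  the first-order condition \<open>\<Sum>k\<le>n. Y\<^sub>k / (1 + \<lambda> Y\<^sub>k) = 0\<close> gives the Bahadur expansion with error
  \<open>O (ln n / sqrt n)\<close>.  Asymptotic normality follows by Slutsky, and the lower bound in probability
  because the normal limit has no atoms.

  For the wealth \<open>W\<^sub>n\<close>, the inequality \<open>sqrt (1 + x) \<le> 1 + x / 2 - c x\<^sup>2\<close> makes
  \<open>sqrt W\<^sub>n \<cdot> exp (c \<sigma>\<^sup>2 (\<Sum>k\<le>n. \<lambda>\<^sub>k\<^sup>2))\<close> a nonnegative supermartingale, hence almost surely bounded
  by the maximal inequality alone, without a convergence theorem; and \<open>\<Sum>k. \<lambda>\<^sub>k\<^sup>2\<close> diverges almost surely since
  \<open>\<lambda>\<^sub>k\<close> is of order at least \<open>1 / sqrt k\<close> in probability and the harmonic series diverges.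
\<close>

section \<open>Quadratic upper bounds for the square root and the logarithm\<close>

text \<open>With \<open>s = sqrt (1 + x)\<close> the gap \<open>1 + x / 2 - s\<close> is exactly
  \<open>(s - 1)\<^sup>2 / 2\<close>, while \<open>x = (s - 1) * (s + 1)\<close> and
  \<open>s + 1\<close> is at most \<open>2 + B\<close>. The upper bound \<open>B\<close> is what
  makes the quadratic gain uniform.\<close>

lemma sqrt_one_plus_le:
  fixes x B :: real
  assumes "-1 \<le> x" "x \<le> B" "0 \<le> B"
  shows "sqrt (1 + x) \<le> 1 + x / 2 - x\<^sup>2 / (2 * (2 + B)\<^sup>2)"
proof -
  define s where "s = sqrt (1 + x)"
  have s: "0 \<le> s" "s\<^sup>2 = 1 + x" using assms by (auto simp: s_def)
  have "1 + x \<le> (1 + B)\<^sup>2" using assms by (simp add: power2_eq_square algebra_simps add_increasing)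
  then have "s \<le> 1 + B" using s assms by (intro power2_le_imp_le[of s "1 + B"]) auto
  then have "(s + 1)\<^sup>2 \<le> (2 + B)\<^sup>2" using s by (intro power_mono) auto
  moreover have "(0::real) < (2 + B)\<^sup>2" using assms by auto
  ultimately have q: "(s + 1)\<^sup>2 / (2 + B)\<^sup>2 \<le> 1" by simp
  have "x\<^sup>2 = (s - 1)\<^sup>2 * (s + 1)\<^sup>2"
  proof -
    have "x = (s - 1) * (s + 1)" using s by (simp add: power2_eq_square algebra_simps)
    then show ?thesis by (simp add: power_mult_distrib)
  qed
  then have "x\<^sup>2 / (2 * (2 + B)\<^sup>2) = (s - 1)\<^sup>2 / 2 * ((s + 1)\<^sup>2 / (2 + B)\<^sup>2)" by simp
  also have "\<dots> \<le> (s - 1)\<^sup>2 / 2" using mult_left_mono[OF q, of "(s - 1)\<^sup>2 / 2"] by simp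
  also have "\<dots> = 1 + x / 2 - s" using s by (simp add: power2_eq_square field_simps)
  finally show ?thesis by (simp add: s_def)
qed

text \<open>The logarithm is twice that of the square root, and \<open>ln s \<le> s - 1\<close>, so
  the bound for the square root carries over with doubled constants.\<close>

lemma ln_one_plus_le:
  fixes x B :: real
  assumes "-1 < x" "x \<le> B" "0 \<le> B"
  shows "ln (1 + x) \<le> x - x\<^sup>2 / (2 + B)\<^sup>2"
proof -
  have "ln (1 + x) = 2 * ln (sqrt (1 + x))" using assms by (simp add: ln_sqrt)
  also have "ln (sqrt (1 + x)) \<le> sqrt (1 + x) - 1" using assms by (intro ln_le_minus_one) auto
  also have "sqrt (1 + x) \<le> 1 + x / 2 - x\<^sup>2 / (2 * (2 + B)\<^sup>2)"
    using assms by (intro sqrt_one_plus_le) auto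
  finally show ?thesis by simp
qed

section \<open>Sums of extended logarithms and the range of the bets\<close>

lemma sum_elog_pos:
  assumes "\<And>k. k \<in> A \<Longrightarrow> 0 < f k"
  shows "(\<Sum>k\<in>A. elog (f k)) = ereal (\<Sum>k\<in>A. ln (f k))"
  using assms by (simp add: elog_def)

text \<open>In \<open>ereal\<close> a sum of both infinities is \<open>\<infinity>\<close>, so one
  infinite negative term decides the sum only because \<open>elog\<close> never takes the value
  \<open>\<infinity>\<close>.\<close>

lemma sum_elog_eq_minf:
  assumes "finite A" "j \<in> A" "f j \<le> 0"
  shows "(\<Sum>k\<in>A. elog (f k)) = -\<infinity>"
proof -
  have "(\<Sum>k\<in>A. elog (f k)) = elog (f j) + (\<Sum>k\<in>A - {j}. elog (f k))"
    using assms by (simp add: sum.remove)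
  moreover have "(\<Sum>k\<in>A - {j}. elog (f k)) \<noteq> \<infinity>"
    by (subst sum_Pinfty) (auto simp: elog_def)
  ultimately show ?thesis using assms by (auto simp: elog_def)
qed

text \<open>The variable \<open>x - m\<close> ranges over an interval from \<open>- m\<close> to
  \<open>1 - m\<close>, and the bet interval is precisely where \<open>1 + l * (x - m)\<close> is
  nonnegative at both ends. The constant \<open>1 / (m * (1 - m))\<close> dominates both
  \<open>1 / m\<close> and \<open>1 / (1 - m)\<close>.\<close>

lemma bet_times_centered_bounds:
  fixes l x m :: real
  assumes m: "0 < m" "m < 1" and l: "l \<in> {- 1 / (1 - m)..1 / m}" and x: "x \<in> {0..1}"
  shows "-1 \<le> l * (x - m)" "\<bar>l\<bar> \<le> 1 / (m * (1 - m))" "l * (x - m) \<le> 1 / (m * (1 - m))"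
proof -
  have 1: "l * m \<le> 1" "- 1 \<le> l * (1 - m)" using m l by (auto simp: field_simps)
  show "-1 \<le> l * (x - m)"
  proof (cases "0 \<le> l")
    case True
    have "l * (- m) \<le> l * (x - m)" using True x by (intro mult_left_mono) auto
    then show ?thesis using 1 by simp
  next
    case False
    have "l * (1 - m) \<le> l * (x - m)" using False x by (intro mult_left_mono_neg) auto
    then show ?thesis using 1 by simp
  qed
  have "1 / m \<le> 1 / (m * (1 - m))" "1 / (1 - m) \<le> 1 / (m * (1 - m))"
    using m by (auto intro!: frac_le mult_left_le mult_left_le_one_le)
  then show 2: "\<bar>l\<bar> \<le> 1 / (m * (1 - m))" using l by auto
  have "l * (x - m) \<le> \<bar>l\<bar> * 1"
    by (rule order.trans[OF abs_ge_self], unfold abs_mult, rule mult_left_mono) (use x m in auto)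
  then show "l * (x - m) \<le> 1 / (m * (1 - m))" using 2 by simp
qed

section \<open>Pathwise analysis of one maximiser: a fixed sample point and the bet that follows
  \<open>n\<close> observations\<close>

context
  fixes X :: "nat \<Rightarrow> 'a \<Rightarrow> real" and m l :: real and n :: nat and \<omega> :: 'a
  assumes m: "0 < m" "m < 1" and n: "0 < n"
    and X: "\<And>k. k \<in> {1..n} \<Longrightarrow> X k \<omega> \<in> {0..1}"
    and max: "is_arg_max (grapa_objective X m (n + 1) \<omega>) (\<lambda>l. l \<in> {- 1 / (1 - m)..1 / m}) l"
begin

lemma grapa_range: "l \<in> {- 1 / (1 - m)..1 / m}"
  using max by (simp add: is_arg_max_def)

text \<open>The bet 0 is admissible with objective 0, whereas a nonpositive factor would give the
  maximiser the objective \<open>-\<infinity>\<close>. From here on the real logarithm can replace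
  \<open>elog\<close>.\<close>

lemma grapa_factor_pos:
  assumes "k \<in> {1..n}" shows "0 < 1 + l * (X k \<omega> - m)"
proof (rule ccontr)
  assume "\<not> ?thesis"
  \<comment> \<open>Since \<open>0 < n\<close>, the prefactor is positive and preserves the infinite
    value.\<close>
  then have "grapa_objective X m (n + 1) \<omega> l = -\<infinity>"
    unfolding grapa_objective_def
    using n assms sum_elog_eq_minf[of "{1..n}" k "\<lambda>k. 1 + l * (X k \<omega> - m)"] by simp
  moreover have "grapa_objective X m (n + 1) \<omega> 0 = 0"
    by (simp add: grapa_objective_def elog_def)
  ultimately show False using max m by (auto simp: is_arg_max_def field_simps)
qed

text \<open>All factors on both sides are positive, so both objectives are finite and the prefactor
  cancels.\<close>

lemma grapa_maximal:
  assumes "l' \<in> {- 1 / (1 - m)..1 / m}" "\<And>k. k \<in> {1..n} \<Longrightarrow> 0 < 1 + l' * (X k \<omega> - m)"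
  shows "(\<Sum>k=1..n. ln (1 + l' * (X k \<omega> - m))) \<le> (\<Sum>k=1..n. ln (1 + l * (X k \<omega> - m)))"
proof -
  have "grapa_objective X m (n + 1) \<omega> l' \<le> grapa_objective X m (n + 1) \<omega> l"
    using max assms(1) by (auto simp: is_arg_max_def not_less)
  moreover have "(\<Sum>k=1..n. elog (1 + l' * (X k \<omega> - m))) = ereal (\<Sum>k=1..n. ln (1 + l' * (X k \<omega> - m)))"
    using assms(2) by (intro sum_elog_pos) auto
  moreover have "(\<Sum>k=1..n. elog (1 + l * (X k \<omega> - m))) = ereal (\<Sum>k=1..n. ln (1 + l * (X k \<omega> - m)))"
    using grapa_factor_pos by (intro sum_elog_pos) auto
  ultimately show ?thesis
    using n by (simp add: grapa_objective_def divide_le_cancel)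
qed

text \<open>A priori localisation, obtained without differentiation: comparing with the bet 0
  through \<open>ln_one_plus_le\<close> yields a quadratic inequality in \<open>l\<close>, from
  which one factor \<open>\<bar>l\<bar>\<close> cancels.\<close>

lemma grapa_abs_le:
  "(\<Sum>k=1..n. (X k \<omega> - m)\<^sup>2) * \<bar>l\<bar> \<le> (2 + 1 / (m * (1 - m)))\<^sup>2 * \<bar>\<Sum>k=1..n. X k \<omega> - m\<bar>"
proof -
  let ?B = "1 / (m * (1 - m))" and ?V = "\<Sum>k=1..n. (X k \<omega> - m)\<^sup>2" and ?S = "\<Sum>k=1..n. X k \<omega> - m"
  define y where "y k = X k \<omega> - m" for k
  have B: "0 < ?B" using m by simp
  then have B2: "0 < (2 + ?B)\<^sup>2" by (intro zero_less_power) linarith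
  have "0 \<le> (\<Sum>k=1..n. ln (1 + l * (X k \<omega> - m)))"
    using grapa_maximal[of 0] m by simp
  also have "\<dots> \<le> (\<Sum>k=1..n. l * (X k \<omega> - m) - (l * (X k \<omega> - m))\<^sup>2 / (2 + ?B)\<^sup>2)"
  proof (intro sum_mono ln_one_plus_le)
    fix k assume k: "k \<in> {1..n}"
    show "-1 < l * (X k \<omega> - m)" using grapa_factor_pos[OF k] by simp
    show "l * (X k \<omega> - m) \<le> ?B" using bet_times_centered_bounds(3)[OF m grapa_range X[OF k]] .
    show "0 \<le> ?B" using B by simp
  qed
  also have "\<dots> = l * ?S - l\<^sup>2 * ?V / (2 + ?B)\<^sup>2"
    unfolding y_def[symmetric]
    by (simp add: sum_subtractf sum_distrib_left sum_divide_distrib power_mult_distrib)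
  finally have "l\<^sup>2 * ?V / (2 + ?B)\<^sup>2 \<le> l * ?S" by simp
  then have *: "l\<^sup>2 * ?V \<le> l * ?S * (2 + ?B)\<^sup>2"
    using B2 by (subst (asm) pos_divide_le_eq)
  have "l * ?S * (2 + ?B)\<^sup>2 \<le> \<bar>l\<bar> * \<bar>?S\<bar> * (2 + ?B)\<^sup>2"
    by (intro mult_right_mono) (auto simp flip: abs_mult)
  with * have "l\<^sup>2 * ?V \<le> \<bar>l\<bar> * ((2 + ?B)\<^sup>2 * \<bar>?S\<bar>)"
    by (simp only: mult.commute mult.left_commute)
  moreover have "l\<^sup>2 * ?V = \<bar>l\<bar> * (?V * \<bar>l\<bar>)"
  proof -
    have "\<bar>l\<bar> * (?V * \<bar>l\<bar>) = (\<bar>l\<bar> * \<bar>l\<bar>) * ?V" by (simp only: ac_simps)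
    then show ?thesis by (simp only: abs_mult_self_eq power2_eq_square)
  qed
  ultimately have "\<bar>l\<bar> * (?V * \<bar>l\<bar>) \<le> \<bar>l\<bar> * ((2 + ?B)\<^sup>2 * \<bar>?S\<bar>)"
    by (simp only:)
  then show ?thesis
    by (cases "l = 0") (auto simp: mult_le_cancel_left_pos)
qed

text \<open>The ball of radius 1/2 around \<open>l\<close> lies within distance less than 1 of 0.
  There every factor is positive, because \<open>X k \<omega> - m\<close> is at most 1 in absolute
  value, and every bet is admissible, because both ends of the bet interval have absolute value at
  least 1. So \<open>l\<close> is a local maximum of a differentiable function.\<close>

lemma grapa_first_order:
  assumes l: "\<bar>l\<bar> \<le> 1 / 2"
  shows "(\<Sum>k=1..n. (X k \<omega> - m) / (1 + l * (X k \<omega> - m))) = 0"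
proof -
  have y: "\<bar>X k \<omega> - m\<bar> \<le> 1" if "k \<in> {1..n}" for k using X[OF that] m by auto
  have pos: "0 < 1 + l' * (X k \<omega> - m)" if "k \<in> {1..n}" "\<bar>l'\<bar> < 1" for k l'
  proof -
    have "\<bar>l' * (X k \<omega> - m)\<bar> \<le> \<bar>l'\<bar> * 1"
      unfolding abs_mult by (intro mult_left_mono y that) auto
    then show ?thesis using that by linarith
  qed
  have D: "DERIV (\<lambda>l'. \<Sum>k=1..n. ln (1 + l' * (X k \<omega> - m))) l :>
          (\<Sum>k=1..n. (X k \<omega> - m) / (1 + l * (X k \<omega> - m)))"
  proof (intro DERIV_sum)
    fix k assume "k \<in> {1..n}"
    then show "((\<lambda>l'. ln (1 + l' * (X k \<omega> - m))) has_real_derivative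
        (X k \<omega> - m) / (1 + l * (X k \<omega> - m))) (at l)"
      using pos[of k l] l by (auto intro!: derivative_eq_intros)
  qed
  show ?thesis
  proof (rule DERIV_local_max[OF D, of "1/2"])
    show "\<forall>l'. \<bar>l - l'\<bar> < 1 / 2 \<longrightarrow>
        (\<Sum>k = 1..n. ln (1 + l' * (X k \<omega> - m))) \<le> (\<Sum>k = 1..n. ln (1 + l * (X k \<omega> - m)))"
    proof (intro allI impI grapa_maximal pos)
      fix l' assume "\<bar>l - l'\<bar> < 1 / 2"
      then show l': "\<bar>l'\<bar> < 1" using l by linarith
      have "1 \<le> 1 / m" "1 \<le> 1 / (1 - m)" using m by auto
      then show "l' \<in> {- 1 / (1 - m)..1 / m}" using l' by auto
    qed
  qed auto
qed

text \<open>An exact algebraic identity expands each summand of the first-order condition to second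
  order in \<open>l\<close>. The cubic remainders are at most 2 each, because
  \<open>\<bar>l\<bar> \<le> 1 / 2\<close> keeps the denominators above 1/2.\<close>

lemma grapa_linearization:
  assumes l: "\<bar>l\<bar> \<le> 1 / 2"
  shows "\<bar>(\<Sum>k=1..n. X k \<omega> - m) - l * (\<Sum>k=1..n. (X k \<omega> - m)\<^sup>2)\<bar> \<le> 2 * real n * l\<^sup>2"
proof -
  define y where "y k = X k \<omega> - m" for k
  have id: "y / (1 + l * y) = (y - l * y\<^sup>2) + l\<^sup>2 * (y ^ 3 / (1 + l * y))" if "1 + l * y \<noteq> 0" for y
    using that by (simp add: field_simps power2_eq_square power3_eq_cube)
  have "0 = (\<Sum>k=1..n. ((X k \<omega> - m) - l * (X k \<omega> - m)\<^sup>2) +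
      l\<^sup>2 * ((X k \<omega> - m) ^ 3 / (1 + l * (X k \<omega> - m))))"
    unfolding grapa_first_order[OF l, symmetric]
  proof (intro sum.cong refl id)
    fix k assume "k \<in> {1..n}"
    then show "1 + l * (X k \<omega> - m) \<noteq> 0" using grapa_factor_pos[of k] by simp
  qed
  also have "\<dots> = ((\<Sum>k=1..n. X k \<omega> - m) - l * (\<Sum>k=1..n. (X k \<omega> - m)\<^sup>2)) +
      l\<^sup>2 * (\<Sum>k=1..n. (X k \<omega> - m) ^ 3 / (1 + l * (X k \<omega> - m)))"
    unfolding y_def[symmetric] by (simp add: sum.distrib sum_subtractf sum_distrib_left)
  finally have "(\<Sum>k=1..n. X k \<omega> - m) - l * (\<Sum>k=1..n. (X k \<omega> - m)\<^sup>2) =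
      - (l\<^sup>2 * (\<Sum>k=1..n. (X k \<omega> - m) ^ 3 / (1 + l * (X k \<omega> - m))))"
    by linarith
  then have "\<bar>(\<Sum>k=1..n. X k \<omega> - m) - l * (\<Sum>k=1..n. (X k \<omega> - m)\<^sup>2)\<bar> =
      l\<^sup>2 * \<bar>\<Sum>k=1..n. (X k \<omega> - m) ^ 3 / (1 + l * (X k \<omega> - m))\<bar>"
    by (simp only: abs_mult abs_minus_cancel abs_power2)
  moreover have "\<bar>\<Sum>k=1..n. (X k \<omega> - m) ^ 3 / (1 + l * (X k \<omega> - m))\<bar> \<le> (\<Sum>k=1..n. 2)"
  proof (intro order.trans[OF sum_abs] sum_mono)
    fix k assume k: "k \<in> {1..n}"
    have y: "\<bar>X k \<omega> - m\<bar> \<le> 1" using X[OF k] m by auto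
    then have y3: "\<bar>X k \<omega> - m\<bar> ^ 3 \<le> 1" by (intro power_le_one) auto
    have "\<bar>l * (X k \<omega> - m)\<bar> \<le> 1 / 2 * 1" unfolding abs_mult using l y by (intro mult_mono) auto
    then have "1 / 2 \<le> 1 + l * (X k \<omega> - m)" by linarith
    then have "\<bar>X k \<omega> - m\<bar> ^ 3 / (1 + l * (X k \<omega> - m)) \<le> 1 / (1 / 2)"
      using y3 by (intro frac_le) auto
    then show "\<bar>(X k \<omega> - m) ^ 3 / (1 + l * (X k \<omega> - m))\<bar> \<le> 2"
      using grapa_factor_pos[OF k] by (simp add: abs_divide power_abs)
  qed
  then have "l\<^sup>2 * \<bar>\<Sum>k=1..n. (X k \<omega> - m) ^ 3 / (1 + l * (X k \<omega> - m))\<bar> \<le> l\<^sup>2 * (\<Sum>k=1..n. 2)"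
    by (rule mult_left_mono) simp
  ultimately show ?thesis by (simp add: mult.commute mult.left_commute)
qed

end

text \<open>The two fluctuation bounds localise the bet at order \<open>sqrt (ln n / n)\<close>.
  Linearising the first-order condition and replacing the empirical second moment by
  \<open>n * \<sigma>\<^sup>2\<close> then each cost a multiple of \<open>ln n\<close>, which is
  divided by \<open>\<sigma>\<^sup>2 * sqrt n\<close> at the end.\<close>

lemma bahadur_pathwise:
  fixes X lam :: "nat \<Rightarrow> 'a \<Rightarrow> real" and m \<sigma> :: real and \<omega> :: 'a
  assumes m: "0 < m" "m < 1" and \<sigma>: "0 < \<sigma>"
    and X: "\<And>k. k \<ge> 1 \<Longrightarrow> X k \<omega> \<in> {0..1}"
    and max: "\<And>n. n \<ge> 1 \<Longrightarrow>
      is_arg_max (grapa_objective X m n \<omega>) (\<lambda>l. l \<in> {- 1 / (1 - m)..1 / m}) (lam n \<omega>)"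
    and S: "\<forall>\<^sub>F n in sequentially. \<bar>\<Sum>k=1..n. X k \<omega> - m\<bar> \<le> sqrt (real n * ln (real n))"
    and V: "\<forall>\<^sub>F n in sequentially.
      \<bar>(\<Sum>k=1..n. (X k \<omega> - m)\<^sup>2) - real n * \<sigma>\<^sup>2\<bar> \<le> sqrt (real n * ln (real n))"
  obtains C where "\<forall>\<^sub>F n in sequentially.
      \<bar>sqrt (real n) * lam (n + 1) \<omega> - 1 / \<sigma>\<^sup>2 * ((\<Sum>k = 1..n. (X k \<omega> - m)) / sqrt (real n))\<bar>
        \<le> C * (ln (real n) / sqrt (real n))"
proof -
  \<comment> \<open>The factor 2 and the division by the variance come from bounding the sum of
    squares below by \<open>n * \<sigma>\<^sup>2 / 2\<close>; the rest is the constant of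
    \<open>grapa_abs_le\<close>.\<close>
  define K where "K = 2 * (2 + 1 / (m * (1 - m)))\<^sup>2 / \<sigma>\<^sup>2"
  have K: "0 \<le> K" by (simp add: K_def)
  \<comment> \<open>\<open>e1\<close> provides that lower bound on the sum of squares;
    \<open>e2\<close> brings the bet into the range where the first-order condition holds.\<close>
  have e1: "\<forall>\<^sub>F n in sequentially. sqrt (real n * ln (real n)) \<le> real n * \<sigma>\<^sup>2 / 2"
    using \<sigma> by real_asymp
  have e2: "\<forall>\<^sub>F n in sequentially. K * sqrt (real n * ln (real n)) / real n \<le> 1 / 2"
    by real_asymp
  \<comment> \<open>In the constant, \<open>2 * K\<^sup>2\<close> pays for the remainder of the
    linearisation and \<open>K\<close> for replacing the sum of squares by its mean.\<close>
  have "\<forall>\<^sub>F n in sequentially.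
      \<bar>sqrt (real n) * lam (n + 1) \<omega> - 1 / \<sigma>\<^sup>2 * ((\<Sum>k = 1..n. (X k \<omega> - m)) / sqrt (real n))\<bar>
        \<le> ((2 * K\<^sup>2 + K) / \<sigma>\<^sup>2) * (ln (real n) / sqrt (real n))"
    using S V e1 e2 eventually_gt_at_top[of 1]
  proof eventually_elim
    case (elim n)
    define l where "l = lam (n + 1) \<omega>"
    define r where "r = sqrt (real n * ln (real n))"
    define S where "S = (\<Sum>k=1..n. X k \<omega> - m)"
    define V where "V = (\<Sum>k=1..n. (X k \<omega> - m)\<^sup>2)"
    have n: "0 < n" "1 < real n" using elim by auto
    have r: "0 \<le> r" "r\<^sup>2 = real n * ln (real n)" using n by (auto simp: r_def)
    note facts = m n(1) X max[of "n + 1", folded l_def]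
    have 1: "V * \<bar>l\<bar> \<le> (2 + 1 / (m * (1 - m)))\<^sup>2 * \<bar>S\<bar>"
      unfolding S_def V_def by (intro grapa_abs_le facts) auto
    have "real n * \<sigma>\<^sup>2 / 2 \<le> V" using elim unfolding V_def by linarith
    then have "real n * \<sigma>\<^sup>2 / 2 * \<bar>l\<bar> \<le> V * \<bar>l\<bar>" by (intro mult_right_mono) auto
    also note 1
    also have "(2 + 1 / (m * (1 - m)))\<^sup>2 * \<bar>S\<bar> \<le> (2 + 1 / (m * (1 - m)))\<^sup>2 * r"
      using elim unfolding S_def r_def by (intro mult_left_mono) auto
    finally have l: "\<bar>l\<bar> \<le> K * r / real n"
      using \<sigma> n by (simp add: K_def field_simps)
    then have l2: "\<bar>l\<bar> \<le> 1 / 2" using elim unfolding r_def by linarith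
    have "\<bar>S - l * V\<bar> \<le> 2 * real n * l\<^sup>2"
      unfolding S_def V_def by (intro grapa_linearization facts l2) auto
    also have "l\<^sup>2 \<le> (K * r / real n)\<^sup>2" using l by (metis abs_ge_zero power2_abs power_mono)
    also have "2 * real n * (K * r / real n)\<^sup>2 = 2 * K\<^sup>2 * ln (real n)"
      using n r(2) by (simp add: power_mult_distrib power_divide) (simp add: power2_eq_square)
    finally have a: "\<bar>S - l * V\<bar> \<le> 2 * K\<^sup>2 * ln (real n)" using n by simp
    have "\<bar>l * (V - real n * \<sigma>\<^sup>2)\<bar> \<le> (K * r / real n) * r"
      unfolding abs_mult using l elim K r unfolding V_def r_def by (intro mult_mono) auto
    also have "\<dots> = K * r\<^sup>2 / real n" by (simp add: power2_eq_square)
    also have "\<dots> = K * ln (real n)" using n r(2) by simp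
    finally have "\<bar>S - l * (real n * \<sigma>\<^sup>2)\<bar> \<le> (2 * K\<^sup>2 + K) * ln (real n)"
      using a by (simp add: algebra_simps)
    moreover have "sqrt (real n) * l - 1 / \<sigma>\<^sup>2 * (S / sqrt (real n)) =
        - (S - l * (real n * \<sigma>\<^sup>2)) / (\<sigma>\<^sup>2 * sqrt (real n))"
      using n \<sigma> by (simp add: field_simps)
    then have "\<bar>sqrt (real n) * l - 1 / \<sigma>\<^sup>2 * (S / sqrt (real n))\<bar> =
        \<bar>S - l * (real n * \<sigma>\<^sup>2)\<bar> / (\<sigma>\<^sup>2 * sqrt (real n))"
      by (simp only: abs_divide abs_mult abs_minus_cancel abs_power2) (simp add: abs_mult)
    ultimately show ?case
      using \<sigma> n unfolding l_def S_def by (simp add: divide_right_mono)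
  qed
  then show thesis by (rule that)
qed

section \<open>Weak convergence, and reindexing of independent families\<close>

context prob_space
begin

text \<open>Characteristic functions reduce this to dominated convergence: the distance between
  \<open>iexp (t * A n \<omega>)\<close> and \<open>iexp (t * B n \<omega>)\<close> depends only on
  the difference \<open>A n \<omega> - B n \<omega>\<close>, tends to 0 almost surely and is at most
  2.\<close>

lemma weak_conv_m_Slutsky:
  fixes A B :: "nat \<Rightarrow> 'a \<Rightarrow> real"
  assumes [measurable]: "\<And>n. A n \<in> borel_measurable M" "\<And>n. B n \<in> borel_measurable M"
    and N: "real_distribution N"
    and conv: "weak_conv_m (\<lambda>n. distr M borel (B n)) N"
    and diff: "AE \<omega> in M. (\<lambda>n. A n \<omega> - B n \<omega>) \<longlonglongrightarrow> 0"
  shows "weak_conv_m (\<lambda>n. distr M borel (A n)) N"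
proof (rule levy_continuity)
  show "real_distribution (distr M borel (A n))" for n by (rule real_distribution_distr) simp
  show "real_distribution N" by fact
  fix t :: real
  have char_eq: "char (distr M borel f) t = (CLINT \<omega>|M. iexp (t * f \<omega>))"
    if "f \<in> borel_measurable M" for f using that by (simp add: char_def integral_distr)
  have int: "integrable M (\<lambda>\<omega>. iexp (t * A n \<omega>))" "integrable M (\<lambda>\<omega>. iexp (t * B n \<omega>))" for n
    by (rule integrable_const_bound[where B=1]; simp)+
  have "(\<lambda>n. CLINT \<omega>|M. iexp (t * A n \<omega>) - iexp (t * B n \<omega>)) \<longlonglongrightarrow> (CLINT \<omega>|M. 0)"
  proof (rule integral_dominated_convergence[where w="\<lambda>_. 2"])
    show "AE \<omega> in M. (\<lambda>n. iexp (t * A n \<omega>) - iexp (t * B n \<omega>)) \<longlonglongrightarrow> 0"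
      using diff
    proof eventually_elim
      case (elim \<omega>)
      have "(\<lambda>n. iexp (t * (A n \<omega> - B n \<omega>)) - 1) \<longlonglongrightarrow> iexp (t * 0) - 1"
        by (intro tendsto_intros elim)
      then have "(\<lambda>n. cmod (iexp (t * (A n \<omega> - B n \<omega>)) - 1)) \<longlonglongrightarrow> 0"
        by (auto dest: tendsto_norm_zero)
      moreover have "cmod (iexp (t * (A n \<omega> - B n \<omega>)) - 1) =
          cmod (iexp (t * A n \<omega>) - iexp (t * B n \<omega>))" for n
      proof -
        have "iexp (t * A n \<omega>) - iexp (t * B n \<omega>) =
            iexp (t * B n \<omega>) * (iexp (t * (A n \<omega> - B n \<omega>)) - 1)"
          by (simp add: algebra_simps flip: exp_add)
        then show ?thesis by (simp only: norm_mult norm_exp_i_times mult_1)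
      qed
      ultimately show ?case by (simp only: tendsto_norm_zero_iff)
    qed
    show "AE \<omega> in M. cmod (iexp (t * A n \<omega>) - iexp (t * B n \<omega>)) \<le> 2" for n
      by (rule AE_I2, rule order.trans[OF norm_triangle_ineq4]) simp
  qed auto
  then have "(\<lambda>n. char (distr M borel (A n)) t - char (distr M borel (B n)) t) \<longlonglongrightarrow> 0"
    unfolding Bochner_Integration.integral_diff[OF int] char_eq[symmetric, OF assms(1)]
      char_eq[symmetric, OF assms(2)] by simp
  moreover have "(\<lambda>n. char (distr M borel (B n)) t) \<longlonglongrightarrow> char N t"
    by (rule levy_continuity1[OF _ N conv]) (rule real_distribution_distr, simp)
  ultimately show "(\<lambda>n. char (distr M borel (A n)) t) \<longlonglongrightarrow> char N t"
    using tendsto_add[of "\<lambda>n. char (distr M borel (A n)) t - char (distr M borel (B n)) t" 0] by fastforce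
qed

text \<open>Scaling by \<open>c\<close> moves the argument of the characteristic function from
  \<open>t\<close> to \<open>t * c\<close>.\<close>

lemma weak_conv_m_mult_left:
  fixes B :: "nat \<Rightarrow> 'a \<Rightarrow> real"
  assumes [measurable]: "\<And>n. B n \<in> borel_measurable M"
    and N: "real_distribution N"
    and conv: "weak_conv_m (\<lambda>n. distr M borel (B n)) N"
  shows "weak_conv_m (\<lambda>n. distr M borel (\<lambda>\<omega>. c * B n \<omega>)) (distr N borel ((*) c))"
proof (rule levy_continuity)
  interpret N: real_distribution N by fact
  show "real_distribution (distr M borel (\<lambda>\<omega>. c * B n \<omega>))" for n
    by (rule real_distribution_distr) simp
  show "real_distribution (distr N borel ((*) c))"
    by (rule N.real_distribution_distr) simp
  fix t :: real
  have "(\<lambda>n. char (distr M borel (B n)) (t * c)) \<longlonglongrightarrow> char N (t * c)"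
    by (rule levy_continuity1[OF _ N conv]) (rule real_distribution_distr, simp)
  then show "(\<lambda>n. char (distr M borel (\<lambda>\<omega>. c * B n \<omega>)) t) \<longlonglongrightarrow> char (distr N borel ((*) c)) t"
    by (simp add: char_def integral_distr mult.assoc)
qed

text \<open>Absence of atoms enters twice: at 0, so that small intervals around 0 have small
  limiting mass, and at the end points, so that such an interval is a continuity set of the
  limit.\<close>

lemma weak_conv_m_prob_abs_less:
  fixes A :: "nat \<Rightarrow> 'a \<Rightarrow> real"
  assumes [measurable]: "\<And>n. A n \<in> borel_measurable M"
    and N: "real_distribution N" and atomless: "\<And>x. measure N {x} = 0"
    and conv: "weak_conv_m (\<lambda>n. distr M borel (A n)) N"
    and \<epsilon>: "0 < \<epsilon>"
  obtains \<delta> where "0 < \<delta>" "\<forall>\<^sub>F n in sequentially. prob {\<omega> \<in> space M. \<bar>A n \<omega>\<bar> < \<delta>} < \<epsilon>"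
proof -
  interpret N: real_distribution N by fact
  define d where "d i = 1 / real (Suc i)" for i
  have d: "0 < d i" for i by (simp add: d_def)
  have d_mono: "d j \<le> d i" if "i \<le> j" for i j
    using that unfolding d_def by (intro frac_le) auto
  have "(\<lambda>i. measure N {- d i<..<d i}) \<longlonglongrightarrow> measure N (\<Inter>i. {- d i<..<d i})"
    by (intro N.finite_Lim_measure_decseq)
       (auto simp: decseq_def dest!: d_mono)
  also have "(\<Inter>i. {- d i<..<d i}) = {0}"
  proof (intro equalityI subsetI)
    fix x assume x: "x \<in> (\<Inter>i. {- d i<..<d i})"
    show "x \<in> {0}"
    proof (rule ccontr)
      assume "x \<notin> {0}"
      then obtain i where "d i < \<bar>x\<bar>"
        using reals_Archimedean[of "\<bar>x\<bar>"] by (auto simp: inverse_eq_divide d_def)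
      moreover have "- d i < x" "x < d i" using x by auto
      ultimately show False by linarith
    qed
  qed (use d in auto)
  finally have "\<forall>\<^sub>F i in sequentially. measure N {- d i<..<d i} < \<epsilon>"
    using atomless[of 0] \<epsilon> by (auto dest: order_tendstoD(2))
  then obtain i where i: "measure N {- d i<..<d i} < \<epsilon>"
    by (auto simp: eventually_sequentially)
  define \<delta> where "\<delta> = d i"
  have \<delta>: "0 < \<delta>" by (simp add: \<delta>_def d)
  have "measure N (frontier {-\<delta><..<\<delta>}) = 0"
  proof -
    have "frontier {-\<delta><..<\<delta>} \<subseteq> {-\<delta>} \<union> {\<delta>}"
      using \<delta> by (auto simp: frontier_def)
    then have "measure N (frontier {-\<delta><..<\<delta>}) \<le> measure N ({-\<delta>} \<union> {\<delta>})"
      by (intro N.finite_measure_mono) auto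
    also have "\<dots> \<le> measure N {-\<delta>} + measure N {\<delta>}"
      by (intro measure_Un_le) auto
    finally show ?thesis using atomless[of \<delta>] atomless[of "- \<delta>"] measure_nonneg[of N "frontier {-\<delta><..<\<delta>}"] by linarith
  qed
  then have "(\<lambda>n. measure (distr M borel (A n)) {-\<delta><..<\<delta>}) \<longlonglongrightarrow> measure N {-\<delta><..<\<delta>}"
    by (intro weak_conv_imp_continuity_set_conv[OF _ N conv])
       (auto intro: real_distribution_distr simp: N.emeasure_eq_measure)
  then have "\<forall>\<^sub>F n in sequentially. measure (distr M borel (A n)) {-\<delta><..<\<delta>} < \<epsilon>"
    using i by (auto simp: \<delta>_def dest: order_tendstoD(2))
  moreover have "measure (distr M borel (A n)) {-\<delta><..<\<delta>} = prob {\<omega> \<in> space M. \<bar>A n \<omega>\<bar> < \<delta>}" for n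
    by (subst measure_distr) (auto intro!: arg_cong[where f=prob])
  ultimately show thesis using \<delta> by (intro that) auto
qed

text \<open>Shifts the observations, numbered from 1, to the index set \<open>UNIV\<close> for use
  in the central limit theorem.\<close>

lemma indep_vars_reindex:
  assumes inj: "inj_on f I" and indep: "indep_vars M' X (f ` I)"
  shows "indep_vars (\<lambda>i. M' (f i)) (\<lambda>i. X (f i)) I"
  unfolding indep_vars_def2
proof (intro conjI ballI indep_setsI)
  show "random_variable (M' (f i)) (X (f i))" if "i \<in> I" for i
    using indep that by (auto simp: indep_vars_def2)
  then show "{X (f i) -` A \<inter> space M | A. A \<in> sets (M' (f i))} \<subseteq> events" if "i \<in> I" for i
    using that by (auto intro: measurable_sets)
  fix A J assume J: "J \<noteq> {}" "J \<subseteq> I" "finite J"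
    and A: "\<forall>j\<in>J. A j \<in> {X (f j) -` A \<inter> space M | A. A \<in> sets (M' (f j))}"
  define g where "g = the_inv_into J f"
  have injJ: "inj_on f J" using inj J by (auto intro: inj_on_subset)
  have g: "g (f j) = j" if "j \<in> J" for j
    unfolding g_def by (rule the_inv_into_f_f[OF injJ that])
  have "prob (\<Inter>k\<in>f ` J. A (g k)) = (\<Prod>k\<in>f ` J. prob (A (g k)))"
    using indep J A g unfolding indep_vars_def2 by (intro indep_setsD[of _ "f ` I"]) auto
  then show "prob (\<Inter>j\<in>J. A j) = (\<Prod>j\<in>J. prob (A j))"
    by (simp add: prod.reindex[OF injJ] g cong: prod.cong INF_cong_simp)
qed

section \<open>Almost sure concentration of sums\<close>

text \<open>At deviation \<open>sqrt (n * ln n)\<close> Hoeffding's bound is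
  \<open>2 / n\<^sup>2\<close>, which is summable, so Borel-Cantelli applies. The form for variables
  in the unit interval covers both the observations and their squared deviations.\<close>

lemma AE_eventually_abs_sum_le:
  fixes X :: "nat \<Rightarrow> 'a \<Rightarrow> real"
  assumes indep: "indep_vars (\<lambda>_. borel) X {1..}"
    and X: "\<And>k. k \<ge> 1 \<Longrightarrow> AE \<omega> in M. X k \<omega> \<in> {0..1}"
    and mean: "\<And>k. k \<ge> 1 \<Longrightarrow> expectation (X k) = \<mu>"
  shows "AE \<omega> in M. \<forall>\<^sub>F n in sequentially.
           \<bar>(\<Sum>k=1..n. X k \<omega>) - real n * \<mu>\<bar> \<le> sqrt (real n * ln (real n))"
proof -
  define A where "A n = {\<omega> \<in> space M. sqrt (real n * ln (real n)) \<le> \<bar>(\<Sum>k=1..n. X k \<omega>) - real n * \<mu>\<bar>}" for n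
  have [measurable]: "X k \<in> borel_measurable M" if "k \<ge> 1" for k
    using indep that by (simp add: indep_vars_def2)
  have [measurable]: "A n \<in> events" for n
    unfolding A_def by measurable
  have bound: "prob (A n) \<le> 2 / real n ^ 2" if "n \<ge> 2" for n
  proof -
    interpret H: Hoeffding_ineq M "{1..n}" X "\<lambda>_. 0" "\<lambda>_. 1" "real n * \<mu>"
    proof unfold_locales
      show "indep_vars (\<lambda>_. borel) X {1..n}" by (rule indep_vars_subset[OF indep]) auto
      show "AE x in M. X i x \<in> {0..1}" if "i \<in> {1..n}" for i using X[of i] that by auto
    qed (use mean in auto)
    have "prob (A n) \<le> 2 * exp (-2 * (sqrt (real n * ln (real n)))\<^sup>2 / (\<Sum>i\<in>{1..n}. (1 - 0)\<^sup>2))"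
      unfolding A_def using that by (intro H.Hoeffding_ineq_abs_ge) auto
    also have "\<dots> = 2 * exp (- (2 * ln (real n)))" using that by simp
    also have "\<dots> = 2 / real n ^ 2"
      using that by (simp add: exp_minus exp_double divide_inverse)
    finally show ?thesis .
  qed
  have "summable (\<lambda>n. 2 / real n ^ 2)"
    using summable_mult[OF inverse_power_summable[of 2, where 'a=real], of 2] by (simp add: divide_inverse)
  then have "summable (\<lambda>n. prob (A n))"
    by (rule summable_comparison_test'[where N=2]) (simp only: real_norm_def abs_of_nonneg measure_nonneg bound)
  then have "AE \<omega> in M. \<forall>\<^sub>F n in sequentially. \<omega> \<in> space M - A n"
    by (intro borel_cantelli_AE1) (auto simp: emeasure_eq_measure)
  then show ?thesis
    by (rule AE_mp, intro AE_I2 impI) (auto simp: A_def elim!: eventually_mono)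
qed

section \<open>Divergence of sums of squares from a lower bound in probability\<close>

text \<open>On an event \<open>E\<close> with bounded \<open>\<Sum>k. (L k)\<^sup>2\<close>, summing
  \<open>\<delta>\<^sup>2 / k \<cdot> prob (E \<inter> {\<bar>L k\<bar> \<ge> \<delta> / sqrt k})\<close> over \<open>k\<close> contradicts the divergence of the harmonic
  series as soon as \<open>prob E\<close> exceeds \<open>\<epsilon>\<close>.\<close>

lemma big_Omega_p_imp_not_summable_sq:
  fixes L :: "nat \<Rightarrow> 'a \<Rightarrow> real"
  assumes [measurable]: "\<And>n. L n \<in> borel_measurable M"
    and L: "big_Omega_p M L (\<lambda>n. real n powr (- 1 / 2))"
  shows "AE \<omega> in M. \<not> summable (\<lambda>k. (L k \<omega>)\<^sup>2)"
proof -
  define E where "E K = {\<omega> \<in> space M. \<forall>n. (\<Sum>k<n. (L k \<omega>)\<^sup>2) \<le> real K}" for K :: nat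
  have [measurable]: "E K \<in> events" for K unfolding E_def by measurable
  have small: "prob (E K) \<le> \<epsilon>" if \<epsilon>: "\<epsilon> > 0" for K \<epsilon>
  proof (rule ccontr)
    assume "\<not> prob (E K) \<le> \<epsilon>"
    then have gap: "0 < prob (E K) - \<epsilon>" by simp
    obtain \<delta> where \<delta>: "0 < \<delta>" and "\<forall>\<^sub>F n in sequentially.
        prob {\<omega> \<in> space M. \<delta> * real n powr (- 1 / 2) \<le> \<bar>L n \<omega>\<bar>} \<ge> 1 - \<epsilon>"
      using L \<epsilon> unfolding big_Omega_p_def by blast
    then obtain N where N: "\<And>n. n \<ge> N \<Longrightarrow>
        prob {\<omega> \<in> space M. \<delta> * real n powr (- 1 / 2) \<le> \<bar>L n \<omega>\<bar>} \<ge> 1 - \<epsilon>"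
      by (auto simp: eventually_sequentially)
    define G where "G n = {\<omega> \<in> space M. \<delta> * real n powr (- 1 / 2) \<le> \<bar>L n \<omega>\<bar>}" for n
    have [measurable]: "G n \<in> events" for n unfolding G_def by measurable
    \<comment> \<open>Two events whose probabilities sum to more than 1 must overlap by at least the
      excess.\<close>
    have G: "prob (E K) - \<epsilon> \<le> prob (E K \<inter> G n)" if "n \<ge> N" for n
    proof -
      have "prob (E K \<union> G n) = prob (E K) + prob (G n) - prob (E K \<inter> G n)"
        by (rule measure_Un3) (auto simp: fmeasurable_eq_sets)
      moreover have "prob (E K \<union> G n) \<le> 1" by simp
      ultimately show ?thesis using N[OF that] unfolding G_def by linarith
    qed
    have int: "integrable M (\<lambda>\<omega>. a * indicator (E K \<inter> G k) \<omega>)" for a :: real and k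
      by (intro integrable_mult_right integrable_real_indicator) (auto simp: emeasure_eq_measure)
    \<comment> \<open>The index \<open>Suc (k + N)\<close> stays beyond the threshold
      \<open>N\<close> and is never 0. On \<open>E K\<close> the squares sum to at most
      \<open>K\<close>, so taking expectations bounds the harmonic sums uniformly in
      \<open>n\<close>.\<close>
    have bound: "(\<Sum>k<n. inverse (real (Suc (k + N)))) \<le> real K / (\<delta>\<^sup>2 * (prob (E K) - \<epsilon>))" for n
    proof -
      have "(\<Sum>k<n. \<delta>\<^sup>2 * inverse (real (Suc (k + N))) * (prob (E K) - \<epsilon>)) \<le>
          (\<Sum>k<n. \<delta>\<^sup>2 * inverse (real (Suc (k + N))) * prob (E K \<inter> G (Suc (k + N))))"
        by (intro sum_mono mult_left_mono G) auto
      also have "\<dots> = expectation (\<lambda>\<omega>. \<Sum>k<n. \<delta>\<^sup>2 * inverse (real (Suc (k + N))) * indicator (E K \<inter> G (Suc (k + N))) \<omega>)"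
        by (subst Bochner_Integration.integral_sum[OF int]) auto
      also have "\<dots> \<le> expectation (\<lambda>_. real K)"
      proof (rule integral_mono)
        show "integrable M (\<lambda>\<omega>. \<Sum>k<n. \<delta>\<^sup>2 * inverse (real (Suc (k + N))) * indicator (E K \<inter> G (Suc (k + N))) \<omega>)"
          by (rule Bochner_Integration.integrable_sum) (rule int)
        show "integrable M (\<lambda>_. real K)" by simp
        fix \<omega> assume \<omega>: "\<omega> \<in> space M"
        show "(\<Sum>k<n. \<delta>\<^sup>2 * inverse (real (Suc (k + N))) * indicator (E K \<inter> G (Suc (k + N))) \<omega>) \<le> real K"
        proof (cases "\<omega> \<in> E K")
          case True
          have "(\<Sum>k<n. \<delta>\<^sup>2 * inverse (real (Suc (k + N))) * indicator (E K \<inter> G (Suc (k + N))) \<omega>)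
              \<le> (\<Sum>k<n. (L (Suc N + k) \<omega>)\<^sup>2)"
          proof (rule sum_mono)
            fix k
            let ?j = "Suc (k + N)"
            show "\<delta>\<^sup>2 * inverse (real ?j) * indicator (E K \<inter> G ?j) \<omega> \<le> (L (Suc N + k) \<omega>)\<^sup>2"
            proof (cases "\<omega> \<in> G ?j")
              case True
              then have "(\<delta> * real ?j powr (- 1 / 2))\<^sup>2 \<le> \<bar>L ?j \<omega>\<bar>\<^sup>2"
                using \<delta> by (intro power_mono) (auto simp: G_def)
              moreover have "(real ?j powr (- 1 / 2))\<^sup>2 = inverse (real ?j)"
                by (simp add: powr_minus powr_half_sqrt power_inverse)
              ultimately show ?thesis using True \<open>\<omega> \<in> E K\<close>
                by (simp add: power_mult_distrib add.commute)
            qed simp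
          qed
          also have "\<dots> \<le> (\<Sum>k<Suc N + n. (L k \<omega>)\<^sup>2)"
            by (subst sum.reindex[of "\<lambda>k. Suc N + k" "{..<n}" "\<lambda>k. (L k \<omega>)\<^sup>2", unfolded comp_def, symmetric])
               (auto simp del: sum.lessThan_Suc intro!: sum_mono2)
          also have "\<dots> \<le> real K" using True unfolding E_def by blast
          finally show ?thesis .
        next
          case False
          then have "indicator (E K \<inter> G j) \<omega> = (0::real)" for j by (simp add: indicator_def)
          then show ?thesis by (simp only: mult_zero_right sum.neutral_const of_nat_0_le_iff)
        qed
      qed
      finally have "\<delta>\<^sup>2 * (prob (E K) - \<epsilon>) * (\<Sum>k<n. inverse (real (Suc (k + N)))) \<le> real K"
        by (simp add: sum_distrib_left mult_ac prob_space)
      then show ?thesis using \<delta> gap by (simp add: field_simps)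
    qed
    have "summable (\<lambda>k. inverse (real (Suc (k + N))))"
      by (rule summableI_nonneg_bounded[OF _ bound]) auto
    then have "summable (\<lambda>k. inverse (real (Suc k)))"
      using summable_iff_shift[of "\<lambda>k. inverse (real (Suc k))" N] by simp
    then have "summable (\<lambda>k. inverse (real k))"
      using summable_Suc_iff[of "\<lambda>k. inverse (real k)"] by simp
    then show False using not_summable_harmonic[where 'a=real] by simp
  qed
  have "prob (E K) \<le> 0" for K
    by (rule field_le_epsilon) (simp only: add_0 small)
  then have "AE \<omega> in M. \<omega> \<notin> E K" for K
    by (intro AE_not_in) (auto simp: null_sets_def emeasure_eq_measure measure_le_0_iff)
  then have "AE \<omega> in M. \<forall>K. \<omega> \<notin> E K" by (simp add: AE_all_countable)
  then show ?thesis
  \<comment> \<open>A path with summable squares lies in \<open>E K\<close> for any natural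
    \<open>K\<close> above its sum.\<close>
  proof (rule AE_mp, intro AE_I2 impI notI)
    fix \<omega> assume \<omega>: "\<omega> \<in> space M" "\<forall>K. \<omega> \<notin> E K" and sum: "summable (\<lambda>k. (L k \<omega>)\<^sup>2)"
    obtain K :: nat where K: "(\<Sum>k. (L k \<omega>)\<^sup>2) \<le> real K" using real_arch_simple by blast
    have "(\<Sum>k<n. (L k \<omega>)\<^sup>2) \<le> real K" for n
      using sum_le_suminf[OF sum, of "{..<n}"] K by force
    then show False using \<omega> by (auto simp: E_def)
  qed
qed

section \<open>Maximal inequality and boundedness of nonnegative supermartingales\<close>

text \<open>The supermartingale property is phrased through integrals over sets of
  \<open>F n\<close> instead of conditional expectations. It is applied to the complement of
  \<open>H n\<close>, the event that level \<open>a\<close> has been reached by time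
  \<open>n\<close>.\<close>

lemma supermartingale_maximal_inequality:
  fixes Z :: "nat \<Rightarrow> 'a \<Rightarrow> real" and F :: "nat \<Rightarrow> 'a measure"
  assumes sub: "\<And>n. subalgebra M (F n)" and mono: "\<And>n. subalgebra (F (Suc n)) (F n)"
    and adapted: "\<And>n. Z n \<in> borel_measurable (F n)"
    and int: "\<And>n. integrable M (Z n)" and nonneg: "\<And>n. AE \<omega> in M. 0 \<le> Z n \<omega>"
    and super: "\<And>n A. A \<in> sets (F n) \<Longrightarrow>
      expectation (\<lambda>\<omega>. indicator A \<omega> * Z (Suc n) \<omega>) \<le> expectation (\<lambda>\<omega>. indicator A \<omega> * Z n \<omega>)"
  shows "a * prob {\<omega> \<in> space M. \<exists>k\<le>n. a \<le> Z k \<omega>} \<le> expectation (Z 0)"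
proof -
  have space_F: "space (F n) = space M" for n using sub by (simp add: subalgebra_def)
  define H where "H n = {\<omega> \<in> space M. \<exists>k\<le>n. a \<le> Z k \<omega>}" for n
  have H: "H n \<in> sets (F n)" for n
  proof (induction n)
    case 0
    have "{\<omega> \<in> space (F 0). a \<le> Z 0 \<omega>} \<in> sets (F 0)" using adapted[of 0] by measurable
    then show ?case by (simp add: H_def space_F)
  next
    case (Suc n)
    have "{\<omega> \<in> space (F (Suc n)). a \<le> Z (Suc n) \<omega>} \<in> sets (F (Suc n))"
      using adapted[of "Suc n"] by measurable
    moreover have "H (Suc n) = H n \<union> {\<omega> \<in> space (F (Suc n)). a \<le> Z (Suc n) \<omega>}"
      by (auto simp: H_def space_F le_Suc_eq)
    ultimately show ?case using Suc mono[of n] by (auto simp: subalgebra_def)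
  qed
  have H_M [measurable]: "H n \<in> events" for n using H sub by (auto simp: subalgebra_def)
  have [measurable]: "Z n \<in> borel_measurable M" for n using int by auto
  have int_ind: "integrable M (\<lambda>\<omega>. indicator A \<omega> * Z n \<omega>)" if "A \<in> events" for A n
    using integrable_mult_indicator[OF that int[of n]] by simp
  have int_a: "integrable M (\<lambda>\<omega>. a * indicator A \<omega>)" if "A \<in> events" for A
    using that by (intro integrable_mult_right integrable_real_indicator) (auto simp: emeasure_eq_measure)
  have add: "a * prob A + expectation (\<lambda>\<omega>. indicator B \<omega> * Z n \<omega>) =
      expectation (\<lambda>\<omega>. a * indicator A \<omega> + indicator B \<omega> * Z n \<omega>)"
    if "A \<in> events" "B \<in> events" for A B n
    using that by (subst Bochner_Integration.integral_add[OF int_a int_ind]) auto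
  \<comment> \<open>The invariant is the expectation of the process stopped on reaching
    \<open>a\<close>, with the stopped value replaced by its lower bound \<open>a\<close>.\<close>
  have "a * prob (H n) + expectation (\<lambda>\<omega>. indicator (space M - H n) \<omega> * Z n \<omega>) \<le> expectation (Z 0)"
  proof (induction n)
    case 0
    have "a * prob (H 0) + expectation (\<lambda>\<omega>. indicator (space M - H 0) \<omega> * Z 0 \<omega>) =
        expectation (\<lambda>\<omega>. a * indicator (H 0) \<omega> + indicator (space M - H 0) \<omega> * Z 0 \<omega>)"
      by (rule add) auto
    also have "\<dots> \<le> expectation (Z 0)"
      by (intro integral_mono Bochner_Integration.integrable_add int_ind int int_a)
         (auto simp: H_def indicator_def)
    finally show ?case .
  next
    case (Suc n)
    have sub_H: "H n \<subseteq> H (Suc n)" unfolding H_def using le_SucI by blast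
    have "a * prob (H (Suc n)) + expectation (\<lambda>\<omega>. indicator (space M - H (Suc n)) \<omega> * Z (Suc n) \<omega>) =
        a * prob (H n) + (a * prob (H (Suc n) - H n) +
          expectation (\<lambda>\<omega>. indicator (space M - H (Suc n)) \<omega> * Z (Suc n) \<omega>))"
      using sub_H by (simp add: finite_measure_Diff algebra_simps)
    also have "a * prob (H (Suc n) - H n) + expectation (\<lambda>\<omega>. indicator (space M - H (Suc n)) \<omega> * Z (Suc n) \<omega>) =
        expectation (\<lambda>\<omega>. a * indicator (H (Suc n) - H n) \<omega> + indicator (space M - H (Suc n)) \<omega> * Z (Suc n) \<omega>)"
      by (rule add) auto
    \<comment> \<open>On the newly added part of \<open>H (Suc n)\<close> the current value is at
      least \<open>a\<close>.\<close>
    also have "\<dots> \<le> expectation (\<lambda>\<omega>. indicator (space M - H n) \<omega> * Z (Suc n) \<omega>)"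
    proof (intro integral_mono Bochner_Integration.integrable_add int_ind int_a)
      fix \<omega> assume "\<omega> \<in> space M"
      then show "a * indicator (H (Suc n) - H n) \<omega> + indicator (space M - H (Suc n)) \<omega> * Z (Suc n) \<omega>
          \<le> indicator (space M - H n) \<omega> * Z (Suc n) \<omega>"
        by (auto simp: H_def indicator_def le_Suc_eq)
    qed auto
    also have "\<dots> \<le> expectation (\<lambda>\<omega>. indicator (space M - H n) \<omega> * Z n \<omega>)"
      by (rule super) (metis H sets.compl_sets space_F)
    finally show ?case using Suc.IH by simp
  qed
  moreover have "0 \<le> expectation (\<lambda>\<omega>. indicator (space M - H n) \<omega> * Z n \<omega>)"
    using nonneg[of n] by (intro integral_nonneg_AE) auto
  ultimately show ?thesis unfolding H_def by linarith
qed

text \<open>Letting the horizon grow, the maximal inequality bounds the probability of ever reaching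
  \<open>a\<close> by \<open>expectation (Z 0) / a\<close>. Unbounded paths reach every level, hence
  form a null set.\<close>

lemma supermartingale_AE_bounded:
  fixes Z :: "nat \<Rightarrow> 'a \<Rightarrow> real" and F :: "nat \<Rightarrow> 'a measure"
  assumes sub: "\<And>n. subalgebra M (F n)" and mono: "\<And>n. subalgebra (F (Suc n)) (F n)"
    and adapted: "\<And>n. Z n \<in> borel_measurable (F n)"
    and int: "\<And>n. integrable M (Z n)" and nonneg: "\<And>n. AE \<omega> in M. 0 \<le> Z n \<omega>"
    and super: "\<And>n A. A \<in> sets (F n) \<Longrightarrow>
      expectation (\<lambda>\<omega>. indicator A \<omega> * Z (Suc n) \<omega>) \<le> expectation (\<lambda>\<omega>. indicator A \<omega> * Z n \<omega>)"
  shows "AE \<omega> in M. \<exists>C. \<forall>n. Z n \<omega> \<le> C"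
proof -
  have [measurable]: "Z n \<in> borel_measurable M" for n using int by auto
  define H where "H a = {\<omega> \<in> space M. \<exists>k. real a \<le> Z k \<omega>}" for a :: nat
  define U where "U = {\<omega> \<in> space M. \<forall>a::nat. \<exists>k. real a \<le> Z k \<omega>}"
  have [measurable]: "H a \<in> events" for a unfolding H_def by measurable
  have [measurable]: "U \<in> events" unfolding U_def by measurable
  have H: "real a * prob (H a) \<le> expectation (Z 0)" for a
  proof (rule LIMSEQ_le_const2)
    have "(\<lambda>n. prob {\<omega> \<in> space M. \<exists>k\<le>n. real a \<le> Z k \<omega>}) \<longlonglongrightarrow> prob (\<Union>n. {\<omega> \<in> space M. \<exists>k\<le>n. real a \<le> Z k \<omega>})"
      by (intro finite_Lim_measure_incseq) (auto simp: incseq_def intro: order.trans)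
    also have "(\<Union>n. {\<omega> \<in> space M. \<exists>k\<le>n. real a \<le> Z k \<omega>}) = H a" by (auto simp: H_def)
    finally show "(\<lambda>n. real a * prob {\<omega> \<in> space M. \<exists>k\<le>n. real a \<le> Z k \<omega>}) \<longlonglongrightarrow> real a * prob (H a)"
      by (intro tendsto_intros)
    show "\<exists>N. \<forall>n\<ge>N. real a * prob {\<omega> \<in> space M. \<exists>k\<le>n. real a \<le> Z k \<omega>} \<le> expectation (Z 0)"
      using supermartingale_maximal_inequality[of F Z "real a", OF assms] by blast
  qed
  have "prob U \<le> 0"
  proof (rule LIMSEQ_le_const)
    show "(\<lambda>a. expectation (Z 0) / real (Suc a)) \<longlonglongrightarrow> 0"
      by (intro tendsto_divide_0[OF tendsto_const] filterlim_compose[OF _ filterlim_Suc]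
          filterlim_at_top_imp_at_infinity filterlim_real_sequentially)
    have "prob U \<le> expectation (Z 0) / real (Suc a)" for a
    proof -
      have "prob U \<le> prob (H (Suc a))" by (intro finite_measure_mono) (use \<open>H (Suc a) \<in> events\<close> in \<open>unfold U_def H_def, blast+\<close>)
      also have "\<dots> \<le> expectation (Z 0) / real (Suc a)"
        using H[of "Suc a"] by (simp add: field_simps)
      finally show ?thesis .
    qed
    then show "\<exists>N. \<forall>a\<ge>N. prob U \<le> expectation (Z 0) / real (Suc a)" by blast
  qed
  then have "AE \<omega> in M. \<omega> \<notin> U"
    by (intro AE_not_in) (auto simp: null_sets_def emeasure_eq_measure measure_le_0_iff)
  then show ?thesis
    by (rule AE_mp, intro AE_I2 impI) (force simp: U_def not_le intro: less_imp_le)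
qed

section \<open>The sigma-algebras of the observations\<close>

lemma
  assumes indep: "indep_vars (\<lambda>_. borel) X {1..}"
  shows subalgebra_sigma_gen_by: "I \<subseteq> {1..} \<Longrightarrow> subalgebra M (sigma_gen_by M X I)"
    and sigma_gen_by_mono: "I \<subseteq> J \<Longrightarrow> subalgebra (sigma_gen_by M X J) (sigma_gen_by M X I)"
    and measurable_sigma_gen_by: "i \<in> I \<Longrightarrow> X i \<in> borel_measurable (sigma_gen_by M X I)"
proof -
  have rv: "X i \<in> borel_measurable M" if "i \<ge> 1" for i using indep that by (simp add: indep_vars_def2)
  have sets_gen: "sets (sigma_gen_by M X I) =
      sigma_sets (space M) (\<Union>i\<in>I. {X i -` A \<inter> space M | A. A \<in> sets borel})"
    and space_gen: "space (sigma_gen_by M X I) = space M" for I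
    by (auto simp: sigma_gen_by_def space_measure_of_conv intro!: sets_measure_of)
  show "subalgebra M (sigma_gen_by M X I)" if "I \<subseteq> {1..}"
    unfolding subalgebra_def sets_gen space_gen using rv that
    by (auto intro!: sets.sigma_sets_subset measurable_sets)
  show "subalgebra (sigma_gen_by M X J) (sigma_gen_by M X I)" if "I \<subseteq> J"
    unfolding subalgebra_def sets_gen space_gen using that by (auto intro!: sigma_sets_mono')
  show "X i \<in> borel_measurable (sigma_gen_by M X I)" if "i \<in> I"
    by (rule measurableI) (use that in \<open>auto simp: sets_gen space_gen intro!: sigma_sets.Basic\<close>)
qed

text \<open>Independence of the single observations passes to the sigma-algebras generated by
  disjoint blocks, and everything generated by \<open>f\<close> lies in that of the past
  block.\<close>

lemma indep_var_sigma_gen_by_next: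
  assumes indep: "indep_vars (\<lambda>_. borel) X {1..}"
    and f: "f \<in> borel_measurable (sigma_gen_by M X {1..n})"
  shows "indep_var borel f borel (X (Suc n))"
proof -
  define E where "E = (\<lambda>i. {X i -` A \<inter> space M | A. A \<in> sets borel})"
  have rv: "X i \<in> borel_measurable M" if "i \<ge> 1" for i using indep that by (simp add: indep_vars_def2)
  have sets_gen: "sets (sigma_gen_by M X I) = sigma_sets (space M) (\<Union>i\<in>I. E i)" for I
    by (auto simp: sigma_gen_by_def E_def intro!: sets_measure_of)
  have space_gen: "space (sigma_gen_by M X I) = space M" for I
    by (simp add: sigma_gen_by_def space_measure_of_conv)
  have Int_stable: "Int_stable (E i)" for i
    unfolding Int_stable_def E_def
  proof safe
    fix A B :: "real set" assume "A \<in> sets borel" "B \<in> sets borel"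
    then show "\<exists>C. X i -` A \<inter> space M \<inter> (X i -` B \<inter> space M) = X i -` C \<inter> space M \<and> C \<in> sets borel"
      by (intro exI[of _ "A \<inter> B"]) auto
  qed
  \<comment> \<open>The two blocks, past and next observation, are indexed by \<open>bool\<close>,
    which matches the definition of \<open>indep_set\<close>.\<close>
  have "indep_sets (\<lambda>j. sigma_sets (space M) (\<Union>i\<in>case_bool {1..n} {Suc n} j. E i)) UNIV"
  proof (rule indep_sets_collect_sigma)
    have "indep_sets E {1..}" using indep by (simp add: indep_vars_def2 E_def)
    then show "indep_sets E (\<Union>j\<in>UNIV. case_bool {1..n} {Suc n} j)"
      by (rule indep_sets_mono_index[rotated]) (auto split: bool.splits)
    show "disjoint_family_on (case_bool {1..n} {Suc n}) UNIV"
      by (auto simp: disjoint_family_on_def split: bool.splits)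
  qed (rule Int_stable)
  moreover have "(\<lambda>j. sigma_sets (space M) (\<Union>i\<in>case_bool {1..n} {Suc n} j. E i)) =
      case_bool (sets (sigma_gen_by M X {1..n})) (sigma_sets (space M) (E (Suc n)))"
    by (auto simp: fun_eq_iff sets_gen split: bool.split)
  ultimately have ind: "indep_set (sets (sigma_gen_by M X {1..n})) (sigma_sets (space M) (E (Suc n)))"
    by (simp add: indep_set_def)
  have "indep_set (sigma_sets (space M) {f -` A \<inter> space M | A. A \<in> sets borel})
      (sigma_sets (space M) (E (Suc n)))"
    unfolding indep_sets2_eq
  proof (intro conjI ballI)
    have sub: "sigma_sets (space M) {f -` A \<inter> space M | A. A \<in> sets borel} \<subseteq> sets (sigma_gen_by M X {1..n})"
      using measurable_sets[OF f] unfolding space_gen[of "{1..n}", symmetric]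
      by (intro sets.sigma_sets_subset) auto
    then show "sigma_sets (space M) {f -` A \<inter> space M | A. A \<in> sets borel} \<subseteq> events"
      using indep_setD_ev1[OF ind] by blast
    show "sigma_sets (space M) (E (Suc n)) \<subseteq> events"
      using indep_setD_ev2[OF ind] .
    show "prob (a \<inter> b) = prob a * prob b"
      if "a \<in> sigma_sets (space M) {f -` A \<inter> space M | A. A \<in> sets borel}" "b \<in> sigma_sets (space M) (E (Suc n))" for a b
      using that sub by (intro indep_setD[OF ind]) auto
  qed
  moreover have "f \<in> borel_measurable M"
    using measurable_from_subalg[OF subalgebra_sigma_gen_by[OF indep] f] by auto
  ultimately show ?thesis
    using rv[of "Suc n"] unfolding indep_var_eq E_def by auto
qed

end

section \<open>The betting model and moments of the observations\<close>

locale grapa_model = prob_space M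
  for M :: "'a measure" and P :: "real measure"
    and X lam :: "nat \<Rightarrow> 'a \<Rightarrow> real" and m \<sigma> :: real +
  assumes sets_P: "sets P = sets borel" and P_unit: "AE x in P. x \<in> {0..1}"
    and mean_P: "m = (LINT x|P. x)" and variance_P: "\<sigma>\<^sup>2 = (LINT x|P. (x - m)\<^sup>2)" and \<sigma>_pos: "\<sigma> > 0"
    and indep_X: "indep_vars (\<lambda>_. borel) X {1..}"
    and distr_X: "\<And>k. k \<ge> 1 \<Longrightarrow> distr M borel (X k) = P"
    and grapa: "is_grapa M X m lam"
begin

lemma X_measurable [measurable]: "k \<ge> 1 \<Longrightarrow> X k \<in> borel_measurable M"
  using indep_X by (simp add: indep_vars_def2)

lemma X_unit: "k \<ge> 1 \<Longrightarrow> AE \<omega> in M. X k \<omega> \<in> {0..1}"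
proof -
  assume k: "k \<ge> 1"
  have "AE x in distr M borel (X k). x \<in> {0..1}" using P_unit by (simp only: distr_X[OF k])
  then show ?thesis using k by (subst (asm) AE_distr_iff) auto
qed

lemma X_integral:
  "f \<in> borel_measurable borel \<Longrightarrow> k \<ge> 1 \<Longrightarrow> expectation (\<lambda>\<omega>. f (X k \<omega>)) = (LINT x|P. f x :: real)"
  by (subst distr_X[symmetric, of k]) (auto simp: integral_distr)

lemma X_mean: "k \<ge> 1 \<Longrightarrow> expectation (X k) = m"
  using X_integral[of "\<lambda>x. x" k] mean_P by simp

lemma X_variance: "k \<ge> 1 \<Longrightarrow> expectation (\<lambda>\<omega>. (X k \<omega> - m)\<^sup>2) = \<sigma>\<^sup>2"
  using X_integral[of "\<lambda>x. (x - m)\<^sup>2" k] variance_P by simp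

lemma X_integrable: "k \<ge> 1 \<Longrightarrow> integrable M (X k)"
  by (rule integrable_const_bound[where B=1]) (use X_unit[of k] in auto)

lemma X_centered_mean: "k \<ge> 1 \<Longrightarrow> expectation (\<lambda>\<omega>. X k \<omega> - m) = 0"
  using X_mean[of k] X_integrable[of k] by (simp add: prob_space)

lemma mean_bounds: "0 \<le> m" "m \<le> 1"
proof -
  show "0 \<le> m" unfolding X_mean[of 1, simplified, symmetric]
    using X_unit[of 1] by (intro integral_nonneg_AE) auto
  have "expectation (X 1) \<le> expectation (\<lambda>_. 1)"
    using X_unit[of 1] by (intro integral_mono_AE X_integrable) auto
  then show "m \<le> 1" using X_mean[of 1] by (simp add: prob_space)
qed

lemma X_centered_sq_unit: "k \<ge> 1 \<Longrightarrow> AE \<omega> in M. (X k \<omega> - m)\<^sup>2 \<in> {0..1}"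
proof -
  assume "k \<ge> 1"
  from X_unit[OF this] show ?thesis
  proof eventually_elim
    case (elim \<omega>)
    then have "\<bar>X k \<omega> - m\<bar> \<le> 1" using mean_bounds by auto
    then show ?case by (simp add: abs_square_le_1)
  qed
qed

lemma X_centered_sq_integrable: "k \<ge> 1 \<Longrightarrow> integrable M (\<lambda>\<omega>. (X k \<omega> - m)\<^sup>2)"
  by (rule integrable_const_bound[where B=1]) (use X_centered_sq_unit[of k] in auto)

text \<open>Squares do not exceed the values on the unit interval, so the variance is at most
  \<open>m * (1 - m)\<close>. Positive variance thus excludes the degenerate bet intervals in which
  HOL evaluates a division by zero to 0.\<close>

lemma mean_interior: "0 < m" "m < 1"
proof -
  have X1: "integrable M (X 1)" by (rule X_integrable) simp
  have "\<sigma>\<^sup>2 = expectation (\<lambda>\<omega>. (X 1 \<omega> - m)\<^sup>2)" using X_variance[of 1] by simp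
  also have "\<dots> \<le> expectation (\<lambda>\<omega>. (1 - 2 * m) * X 1 \<omega> + m\<^sup>2)"
  proof (rule integral_mono_AE)
    show "AE \<omega> in M. (X 1 \<omega> - m)\<^sup>2 \<le> (1 - 2 * m) * X 1 \<omega> + m\<^sup>2"
      using X_unit[OF order.refl]
    proof eventually_elim
      case (elim \<omega>)
      then have "X 1 \<omega> * X 1 \<omega> \<le> X 1 \<omega> * 1" by (intro mult_left_mono) auto
      then show ?case by (simp add: power2_eq_square algebra_simps)
    qed
    show "integrable M (\<lambda>\<omega>. (1 - 2 * m) * X 1 \<omega> + m\<^sup>2)"
      using X1 by (intro Bochner_Integration.integrable_add integrable_mult_right) auto
  qed (rule X_centered_sq_integrable, simp)
  also have "\<dots> = (1 - 2 * m) * expectation (X 1) + m\<^sup>2"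
    using X1 by (simp add: prob_space)
  also have "\<dots> = m * (1 - m)"
    unfolding X_mean[OF order.refl] by (simp add: power2_eq_square algebra_simps)
  finally have "0 < m * (1 - m)" using zero_less_power[OF \<sigma>_pos, of 2] by (rule order.strict_trans2[rotated])
  then show "0 < m" "m < 1" using mean_bounds by (auto simp: zero_less_mult_iff)
qed

lemma AE_all_unit: "AE \<omega> in M. \<forall>k\<ge>1. X k \<omega> \<in> {0..1}"
  using X_unit by (auto simp: AE_all_countable)

lemma AE_all_argmax: "AE \<omega> in M. \<forall>n\<ge>1.
    is_arg_max (grapa_objective X m n \<omega>) (\<lambda>l. l \<in> {- 1 / (1 - m)..1 / m}) (lam n \<omega>)"
  using grapa by (auto simp: is_grapa_def AE_all_countable)

text \<open>Predictability of the bets. \<open>is_grapa\<close> speaks of \<open>lam n\<close> only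
  for \<open>n \<ge> 1\<close>, hence the index \<open>Suc n\<close>.\<close>

lemma lam_measurable_sigma_gen_by:
  "lam (Suc n) \<in> borel_measurable (sigma_gen_by M X {1..n})"
  using grapa unfolding is_grapa_def by (elim allE[of _ "Suc n"]) simp

lemma lam_measurable [measurable]: "lam (Suc n) \<in> borel_measurable M"
  using subalgebra_sigma_gen_by[OF indep_X] lam_measurable_sigma_gen_by
  by (rule measurable_from_subalg) auto

section \<open>The almost sure Bahadur expansion\<close>

text \<open>Concentration is applied to the observations and to their squared deviations; off a null
  set the pathwise expansion follows, with a constant depending on the path.\<close>

lemma bahadur: "AE \<omega> in M. \<exists>C. \<forall>\<^sub>F n in sequentially.
    \<bar>sqrt (real n) * lam (n + 1) \<omega> - 1 / \<sigma>\<^sup>2 * ((\<Sum>k = 1..n. (X k \<omega> - m)) / sqrt (real n))\<bar>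
      \<le> C * (ln (real n) / sqrt (real n))"
proof -
  have 1: "AE \<omega> in M. \<forall>\<^sub>F n in sequentially.
      \<bar>(\<Sum>k=1..n. X k \<omega>) - real n * m\<bar> \<le> sqrt (real n * ln (real n))"
    by (rule AE_eventually_abs_sum_le[OF indep_X]) (fact X_unit X_mean)+
  have 2: "AE \<omega> in M. \<forall>\<^sub>F n in sequentially.
      \<bar>(\<Sum>k=1..n. (X k \<omega> - m)\<^sup>2) - real n * \<sigma>\<^sup>2\<bar> \<le> sqrt (real n * ln (real n))"
  proof (rule AE_eventually_abs_sum_le[of "\<lambda>k \<omega>. (X k \<omega> - m)\<^sup>2"])
    show "indep_vars (\<lambda>_. borel) (\<lambda>k \<omega>. (X k \<omega> - m)\<^sup>2) {1..}"
      by (rule indep_vars_compose2[OF indep_X]) simp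
  qed (fact X_centered_sq_unit X_variance)+
  show ?thesis
    using 1 2 AE_all_unit AE_all_argmax
  proof eventually_elim
    case (elim \<omega>)
    have S: "\<forall>\<^sub>F n in sequentially. \<bar>\<Sum>k=1..n. X k \<omega> - m\<bar> \<le> sqrt (real n * ln (real n))"
      using elim(1) by (simp add: sum_subtractf)
    show ?case
      by (rule bahadur_pathwise[OF mean_interior \<sigma>_pos, of X \<omega> lam]) (use elim(2-4) S in blast)+
  qed
qed

text \<open>The ratio of \<open>ln n / sqrt n\<close> to the claimed rate is
  \<open>n powr (- 1 / 4)\<close>, which tends to 0; \<open>n > 1\<close> keeps \<open>ln n\<close>
  positive so that it cancels.\<close>

lemma bahadur_little_o:
  "little_o_as M
     (\<lambda>n \<omega>. sqrt (real n) * lam (n + 1) \<omega> - 1 / \<sigma>\<^sup>2 * ((\<Sum>k = 1..n. (X k \<omega> - m)) / sqrt (real n)))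
     (\<lambda>n. real n powr (- 1 / 4) * ln (real n))"
  unfolding little_o_as_def using bahadur
proof eventually_elim
  case (elim \<omega>)
  define D where "D n = sqrt (real n) * lam (n + 1) \<omega> -
    1 / \<sigma>\<^sup>2 * ((\<Sum>k = 1..n. (X k \<omega> - m)) / sqrt (real n))" for n
  obtain C where "\<forall>\<^sub>F n in sequentially. \<bar>D n\<bar> \<le> C * (ln (real n) / sqrt (real n))"
    using elim by (auto simp: D_def)
  moreover have "\<forall>\<^sub>F n in sequentially. C * (ln (real n) / sqrt (real n)) / (real n powr (- 1 / 4) * ln (real n))
      = C * real n powr (- 1 / 4)"
    using eventually_gt_at_top[of 1]
  proof eventually_elim
    case (elim n)
    then have "sqrt (real n) = inverse (real n powr (- 1 / 4) * real n powr (- 1 / 4))"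
      by (simp add: powr_half_sqrt[symmetric] powr_add[symmetric] powr_minus[symmetric])
    then show ?case using elim by (simp add: field_simps)
  qed
  ultimately have "\<forall>\<^sub>F n in sequentially. norm (D n / (real n powr (- 1 / 4) * ln (real n))) \<le>
      C * real n powr (- 1 / 4)"
    using eventually_gt_at_top[of 1]
  proof eventually_elim
    case (elim n)
    have "norm (D n / (real n powr (- 1 / 4) * ln (real n))) = \<bar>D n\<bar> / (real n powr (- 1 / 4) * ln (real n))"
      using elim by (simp add: abs_divide abs_mult)
    also have "\<dots> \<le> C * (ln (real n) / sqrt (real n)) / (real n powr (- 1 / 4) * ln (real n))"
      using elim by (intro divide_right_mono) auto
    finally show ?case using elim by simp
  qed
  moreover have "(\<lambda>n. C * real n powr (- 1 / 4)) \<longlonglongrightarrow> 0" by real_asymp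
  ultimately show ?case unfolding D_def by (rule Lim_null_comparison)
qed

section \<open>Asymptotic normality\<close>

text \<open>The second parameter of \<open>normal_density\<close> is the standard deviation, so
  \<open>1 / \<sigma>\<close> encodes the limiting variance
  \<open>1 / \<sigma>\<^sup>2\<close>.\<close>

lemma std_normal_scaled:
  "distr std_normal_distribution borel ((*) (1 / \<sigma>)) = density lborel (normal_density 0 (1 / \<sigma>))"
proof -
  interpret S: real_distribution std_normal_distribution by (rule real_dist_normal_dist)
  have "distributed std_normal_distribution lborel (\<lambda>x. x) std_normal_density"
    by (auto simp: distributed_def distr_id2)
  from S.normal_density_affine[OF this, of "1 / \<sigma>" 0]
  have "distributed std_normal_distribution lborel (\<lambda>x. 1 / \<sigma> * x) (normal_density 0 (1 / \<sigma>))"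
    using \<sigma>_pos by simp
  then have "distr std_normal_distribution lborel ((*) (1 / \<sigma>)) = density lborel (normal_density 0 (1 / \<sigma>))"
    by (rule distributed_distr_eq_density)
  moreover have "distr std_normal_distribution borel ((*) (1 / \<sigma>)) =
      distr std_normal_distribution lborel ((*) (1 / \<sigma>))"
    by (rule distr_cong) auto
  ultimately show ?thesis by (simp only:)
qed

lemma real_distribution_limit: "real_distribution (density lborel (normal_density 0 (1 / \<sigma>)))"
proof -
  interpret S: real_distribution std_normal_distribution by (rule real_dist_normal_dist)
  show ?thesis unfolding std_normal_scaled[symmetric] by (rule S.real_distribution_distr) simp
qed

text \<open>The central limit theorem, rescaled by \<open>1 / \<sigma>\<close>, gives the limit of
  the leading term of the expansion, and the error vanishes almost surely.\<close>

lemma asymptotic_normality: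
  "weak_conv_m (\<lambda>n. distr M borel (\<lambda>\<omega>. sqrt (real n) * lam (n + 1) \<omega>))
     (density lborel (normal_density 0 (1 / \<sigma>)))"
proof -
  define Y where "Y i \<omega> = X (Suc i) \<omega> - m" for i \<omega>
  define T where "T n \<omega> = (\<Sum>i<n. Y i \<omega>) / sqrt (real n * \<sigma>\<^sup>2)" for n \<omega>
  have [measurable]: "Y i \<in> borel_measurable M" for i unfolding Y_def by measurable
  have [measurable]: "T n \<in> borel_measurable M" for n unfolding T_def by measurable
  have mean_Y: "expectation (Y i) = 0" for i
    unfolding Y_def by (rule X_centered_mean) simp
  have "weak_conv_m (\<lambda>n. distr M borel (T n)) std_normal_distribution"
    unfolding T_def
  proof (rule central_limit_theorem_zero_mean[where \<mu> = "distr P borel (\<lambda>x. x - m)"])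
    have "indep_vars (\<lambda>_. borel) (\<lambda>i. X (Suc i)) UNIV"
      by (rule indep_vars_reindex[where f=Suc]) (auto intro!: indep_vars_subset[OF indep_X])
    then show "indep_vars (\<lambda>_. borel) Y UNIV"
      unfolding Y_def[abs_def] by (rule indep_vars_compose2) auto
    show "integrable M (\<lambda>x. (Y n x)\<^sup>2)" for n
      unfolding Y_def by (rule X_centered_sq_integrable) simp
    show "variance (Y n) = \<sigma>\<^sup>2" for n
      unfolding mean_Y using X_variance[of "Suc n"] by (simp add: Y_def)
    show "distr M borel (Y n) = distr P borel (\<lambda>x. x - m)" for n
      by (subst distr_X[of "Suc n", symmetric]) (auto simp: Y_def[abs_def] distr_distr comp_def)
  qed (use mean_Y \<sigma>_pos in auto)
  then have "weak_conv_m (\<lambda>n. distr M borel (\<lambda>\<omega>. 1 / \<sigma> * T n \<omega>))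
      (density lborel (normal_density 0 (1 / \<sigma>)))"
    unfolding std_normal_scaled[symmetric]
    by (intro weak_conv_m_mult_left real_dist_normal_dist) auto
  moreover have "1 / \<sigma> * T n \<omega> = 1 / \<sigma>\<^sup>2 * ((\<Sum>k = 1..n. (X k \<omega> - m)) / sqrt (real n))" for n \<omega>
  proof -
    have "(\<Sum>i<n. Y i \<omega>) = (\<Sum>k = 1..n. (X k \<omega> - m))"
      unfolding Y_def by (rule sum.reindex_bij_witness[of _ "\<lambda>k. k - 1" Suc]) auto
    then show ?thesis
      using \<sigma>_pos by (simp add: T_def real_sqrt_mult power2_eq_square)
  qed
  ultimately have "weak_conv_m (\<lambda>n. distr M borel (\<lambda>\<omega>. 1 / \<sigma>\<^sup>2 * ((\<Sum>k = 1..n. (X k \<omega> - m)) / sqrt (real n))))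
      (density lborel (normal_density 0 (1 / \<sigma>)))"
    by simp
  then show ?thesis
  proof (rule weak_conv_m_Slutsky[rotated 3])
    show "(\<lambda>\<omega>. sqrt (real n) * lam (n + 1) \<omega>) \<in> borel_measurable M" for n
      using lam_measurable[of n] by simp
    show "(\<lambda>\<omega>. 1 / \<sigma>\<^sup>2 * ((\<Sum>k = 1..n. (X k \<omega> - m)) / sqrt (real n))) \<in> borel_measurable M" for n
      by measurable
    show "AE \<omega> in M. (\<lambda>n. sqrt (real n) * lam (n + 1) \<omega> -
        1 / \<sigma>\<^sup>2 * ((\<Sum>k = 1..n. (X k \<omega> - m)) / sqrt (real n))) \<longlonglongrightarrow> 0"
      using bahadur
    proof eventually_elim
      case (elim \<omega>)
      then obtain C where "\<forall>\<^sub>F n in sequentially.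
          norm (sqrt (real n) * lam (n + 1) \<omega> - 1 / \<sigma>\<^sup>2 * ((\<Sum>k = 1..n. (X k \<omega> - m)) / sqrt (real n)))
            \<le> C * (ln (real n) / sqrt (real n))"
        by auto
      moreover have "(\<lambda>n. C * (ln (real n) / sqrt (real n))) \<longlonglongrightarrow> 0" by real_asymp
      ultimately show ?case by (rule Lim_null_comparison)
    qed
  qed (rule real_distribution_limit)
qed

section \<open>Lower bounds in probability for the bets\<close>

lemma atomless_limit: "measure (density lborel (normal_density 0 (1 / \<sigma>))) {x} = 0"
proof -
  have "{x} \<in> null_sets (density lborel (normal_density 0 (1 / \<sigma>)))"
    using absolutely_continuousI_density[of "normal_density 0 (1 / \<sigma>)" lborel]
    unfolding absolutely_continuous_def by (rule subsetD) auto
  then show ?thesis by (rule measure_eq_0_null_sets)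
qed

text \<open>The normal limit puts little mass near 0, so \<open>sqrt n * lam (n + 1)\<close> is
  rarely small. Both forms of the lower bound below derive from this.\<close>

lemma lam_prob_small:
  assumes "0 < \<epsilon>"
  obtains \<delta> where "0 < \<delta>" "\<forall>\<^sub>F n in sequentially.
    prob {\<omega> \<in> space M. \<delta> * real n powr (- 1 / 2) \<le> \<bar>lam (Suc n) \<omega>\<bar>} \<ge> 1 - \<epsilon>"
proof -
  obtain \<delta> where \<delta>: "0 < \<delta>"
    and ev: "\<forall>\<^sub>F n in sequentially. prob {\<omega> \<in> space M. \<bar>sqrt (real n) * lam (n + 1) \<omega>\<bar> < \<delta>} < \<epsilon>"
    by (rule weak_conv_m_prob_abs_less[OF _ real_distribution_limit atomless_limit asymptotic_normality assms]) auto
  from ev eventually_gt_at_top[of 0] have "\<forall>\<^sub>F n in sequentially.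
    prob {\<omega> \<in> space M. \<delta> * real n powr (- 1 / 2) \<le> \<bar>lam (Suc n) \<omega>\<bar>} \<ge> 1 - \<epsilon>"
  proof eventually_elim
    case (elim n)
    have "{\<omega> \<in> space M. \<delta> * real n powr (- 1 / 2) \<le> \<bar>lam (Suc n) \<omega>\<bar>} =
        space M - {\<omega> \<in> space M. \<bar>sqrt (real n) * lam (n + 1) \<omega>\<bar> < \<delta>}"
      using elim by (auto simp: powr_minus powr_half_sqrt abs_mult field_simps not_less)
    also have "prob \<dots> = 1 - prob {\<omega> \<in> space M. \<bar>sqrt (real n) * lam (n + 1) \<omega>\<bar> < \<delta>}"
      using lam_measurable[of n] by (intro prob_compl) simp
    finally show ?case using elim by simp
  qed
  with \<delta> show thesis by (rule that)
qed

text \<open>The shifted form, in which all bets are measurable, feeds the divergence of the sum of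
  squared bets.\<close>

lemma big_Omega_p_lam_Suc: "big_Omega_p M (\<lambda>n. lam (Suc n)) (\<lambda>n. real n powr (- 1 / 2))"
  unfolding big_Omega_p_def
proof (intro allI impI)
  fix \<epsilon> :: real assume "0 < \<epsilon>"
  then obtain \<delta> where "0 < \<delta>" "\<forall>\<^sub>F n in sequentially.
      prob {\<omega> \<in> space M. \<delta> * real n powr (- 1 / 2) \<le> \<bar>lam (Suc n) \<omega>\<bar>} \<ge> 1 - \<epsilon>"
    by (rule lam_prob_small)
  then show "\<exists>\<delta>>0. \<forall>\<^sub>F n in sequentially.
      prob {\<omega> \<in> space M. \<delta> * real n powr (- 1 / 2) \<le> \<bar>lam (Suc n) \<omega>\<bar>} \<ge> 1 - \<epsilon>"
    by (intro exI[of _ \<delta>] conjI)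
qed

text \<open>The rate decreases in \<open>n\<close>, so evaluating it at \<open>Suc n\<close> only
  enlarges the event, and the index can be shifted back.\<close>

lemma big_Omega_p_lam: "big_Omega_p M lam (\<lambda>n. real n powr (- 1 / 2))"
  unfolding big_Omega_p_def
proof (intro allI impI)
  fix \<epsilon> :: real assume "0 < \<epsilon>"
  then obtain \<delta> where \<delta>: "0 < \<delta>" and ev: "\<forall>\<^sub>F n in sequentially.
      prob {\<omega> \<in> space M. \<delta> * real n powr (- 1 / 2) \<le> \<bar>lam (Suc n) \<omega>\<bar>} \<ge> 1 - \<epsilon>"
    by (rule lam_prob_small)
  from ev eventually_gt_at_top[of 0] have "\<forall>\<^sub>F n in sequentially.
      prob {\<omega> \<in> space M. \<delta> * real (Suc n) powr (- 1 / 2) \<le> \<bar>lam (Suc n) \<omega>\<bar>} \<ge> 1 - \<epsilon>"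
  proof eventually_elim
    case (elim n)
    have "real (Suc n) powr (- 1 / 2) \<le> real n powr (- 1 / 2)"
      using elim by (intro powr_mono2') auto
    then have "\<delta> * real (Suc n) powr (- 1 / 2) \<le> \<delta> * real n powr (- 1 / 2)"
      using \<delta> by simp
    then have "prob {\<omega> \<in> space M. \<delta> * real n powr (- 1 / 2) \<le> \<bar>lam (Suc n) \<omega>\<bar>} \<le>
        prob {\<omega> \<in> space M. \<delta> * real (Suc n) powr (- 1 / 2) \<le> \<bar>lam (Suc n) \<omega>\<bar>}"
      by (intro finite_measure_mono) (auto intro: order.trans)
    with elim show ?case by linarith
  qed
  then have "\<forall>\<^sub>F n in sequentially.
      prob {\<omega> \<in> space M. \<delta> * real n powr (- 1 / 2) \<le> \<bar>lam n \<omega>\<bar>} \<ge> 1 - \<epsilon>"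
    by (rule eventually_sequentially_Suc[where P="\<lambda>n.
      prob {\<omega> \<in> space M. \<delta> * real n powr (- 1 / 2) \<le> \<bar>lam n \<omega>\<bar>} \<ge> 1 - \<epsilon>", THEN iffD1])
  then show "\<exists>\<delta>>0. \<forall>\<^sub>F n in sequentially.
      prob {\<omega> \<in> space M. \<delta> * real n powr (- 1 / 2) \<le> \<bar>lam n \<omega>\<bar>} \<ge> 1 - \<epsilon>"
    using \<delta> by (intro exI[of _ \<delta>] conjI)
qed

section \<open>The wealth process\<close>

abbreviation obs :: "nat \<Rightarrow> 'a measure" where "obs n \<equiv> sigma_gen_by M X {1..n}"

definition bet_bound :: real where "bet_bound = 1 / (m * (1 - m))"

text \<open>The coefficient of the quadratic term in \<open>sqrt_one_plus_le\<close> for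
  \<open>B = bet_bound\<close>.\<close>

definition drift :: real where "drift = 1 / (2 * (2 + bet_bound)\<^sup>2)"

text \<open>The exponential compensates the expected loss of the square root of the wealth: given
  the past, round \<open>k\<close> multiplies it on average by at most
  \<open>1 - drift * \<sigma>\<^sup>2 * (lam k \<omega>)\<^sup>2\<close>.\<close>

definition root_wealth :: "nat \<Rightarrow> 'a \<Rightarrow> real" where
  "root_wealth n \<omega> = (\<Prod>k=1..n. sqrt (1 + lam k \<omega> * (X k \<omega> - m))) * exp (drift * \<sigma>\<^sup>2 * (\<Sum>k=1..n. (lam k \<omega>)\<^sup>2))"

lemma bet_bound_pos: "0 < bet_bound" using mean_interior by (simp add: bet_bound_def)

lemma drift_pos: "0 < drift" using bet_bound_pos by (simp add: drift_def zero_less_power)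

lemma AE_bet_bounds: "AE \<omega> in M. \<forall>k\<ge>1. \<bar>lam k \<omega>\<bar> \<le> bet_bound \<and> X k \<omega> \<in> {0..1} \<and>
    -1 \<le> lam k \<omega> * (X k \<omega> - m) \<and> lam k \<omega> * (X k \<omega> - m) \<le> bet_bound"
  using AE_all_unit AE_all_argmax
proof eventually_elim
  case (elim \<omega>)
  then have "lam k \<omega> \<in> {- 1 / (1 - m)..1 / m}" "X k \<omega> \<in> {0..1}" if "k \<ge> 1" for k
    using that unfolding is_arg_max_def by blast+
  then show ?case
    using bet_times_centered_bounds[OF mean_interior, folded bet_bound_def] by blast
qed

lemma obs_subalgebra: "subalgebra M (obs n)"
  by (rule subalgebra_sigma_gen_by[OF indep_X]) auto

lemma obs_mono: "i \<le> n \<Longrightarrow> subalgebra (obs n) (obs i)"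
  by (rule sigma_gen_by_mono[OF indep_X]) auto

lemma root_wealth_adapted: "root_wealth n \<in> borel_measurable (obs n)"
proof -
  have [measurable]: "X k \<in> borel_measurable (obs n)" if "k \<in> {1..n}" for k
    by (rule measurable_sigma_gen_by[OF indep_X that])
  have [measurable]: "lam k \<in> borel_measurable (obs n)" if k: "k \<in> {1..n}" for k
  proof -
    obtain j where "k = Suc j" "j \<le> n" using k by (cases k) auto
    then show ?thesis using measurable_from_subalg[OF obs_mono lam_measurable_sigma_gen_by] by blast
  qed
  show ?thesis unfolding root_wealth_def by measurable
qed

lemma root_wealth_Suc: "root_wealth (Suc n) \<omega> = root_wealth n \<omega> * exp (drift * \<sigma>\<^sup>2 * (lam (Suc n) \<omega>)\<^sup>2) *
    sqrt (1 + lam (Suc n) \<omega> * (X (Suc n) \<omega> - m))"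
  by (simp add: root_wealth_def distrib_left exp_add)

text \<open>The upper bound grows with \<open>n\<close> and serves for integrability at each fixed
  time.\<close>

lemma AE_root_wealth_bounds: "AE \<omega> in M. 0 \<le> root_wealth n \<omega> \<and> root_wealth n \<omega> \<le> sqrt (1 + bet_bound) ^ n * exp (drift * \<sigma>\<^sup>2 * (real n * bet_bound\<^sup>2))"
  using AE_bet_bounds
proof eventually_elim
  case (elim \<omega>)
  have "(lam k \<omega>)\<^sup>2 \<le> bet_bound\<^sup>2" if "k \<in> {1..n}" for k
    using elim that bet_bound_pos by (metis abs_le_square_iff abs_of_pos atLeastAtMost_iff)
  then have "(\<Sum>k=1..n. (lam k \<omega>)\<^sup>2) \<le> (\<Sum>k=1..n. bet_bound\<^sup>2)" by (intro sum_mono)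
  moreover have "(\<Prod>k=1..n. sqrt (1 + lam k \<omega> * (X k \<omega> - m))) \<le> (\<Prod>k=1..n. sqrt (1 + bet_bound))"
    using elim by (intro prod_mono) auto
  moreover have "0 \<le> (\<Prod>k=1..n. sqrt (1 + lam k \<omega> * (X k \<omega> - m)))"
    using elim by (intro prod_nonneg) auto
  ultimately show ?case
    using bet_bound_pos drift_pos \<sigma>_pos unfolding root_wealth_def by (auto intro!: mult_mono mult_left_mono)
qed

lemma root_wealth_integrable: "integrable M (root_wealth n)"
proof (rule integrable_const_bound)
  show "AE \<omega> in M. norm (root_wealth n \<omega>) \<le> sqrt (1 + bet_bound) ^ n * exp (drift * \<sigma>\<^sup>2 * (real n * bet_bound\<^sup>2))"
    using AE_root_wealth_bounds[of n] by eventually_elim simp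
  show "root_wealth n \<in> borel_measurable M"
    by (rule measurable_from_subalg[OF obs_subalgebra root_wealth_adapted])
qed

text \<open>The next observation is independent of the past, so expectations factor: the linear term
  of \<open>sqrt_one_plus_le\<close> vanishes by centring, and the quadratic term produces the
  variance. The resulting loss offsets the exponential factor.\<close>

lemma root_wealth_supermartingale:
  assumes A: "A \<in> sets (obs n)"
  shows "expectation (\<lambda>\<omega>. indicator A \<omega> * root_wealth (Suc n) \<omega>) \<le> expectation (\<lambda>\<omega>. indicator A \<omega> * root_wealth n \<omega>)"
proof -
  \<comment> \<open>\<open>W\<close> collects everything in the integrand that is known before the
    next observation.\<close>
  define W where "W \<omega> = indicator A \<omega> * root_wealth n \<omega> * exp (drift * \<sigma>\<^sup>2 * (lam (Suc n) \<omega>)\<^sup>2)" for \<omega>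
  define l where "l = lam (Suc n)"
  define Y where "Y \<omega> = X (Suc n) \<omega> - m" for \<omega>
  have lF: "l \<in> borel_measurable (obs n)" unfolding l_def by (rule lam_measurable_sigma_gen_by)
  have WF: "W \<in> borel_measurable (obs n)"
    unfolding W_def l_def[symmetric] using A lF root_wealth_adapted[of n] by measurable
  have WM [measurable]: "W \<in> borel_measurable M" and lM [measurable]: "l \<in> borel_measurable M"
    using measurable_from_subalg[OF obs_subalgebra] WF lF by auto
  have [measurable]: "Y \<in> borel_measurable M" unfolding Y_def by measurable
  obtain K where K: "AE \<omega> in M. 0 \<le> W \<omega> \<and> W \<omega> \<le> K \<and> \<bar>l \<omega>\<bar> \<le> bet_bound"
  proof
    show "AE \<omega> in M. 0 \<le> W \<omega> \<and> W \<omega> \<le> sqrt (1 + bet_bound) ^ n * exp (drift * \<sigma>\<^sup>2 * (real n * bet_bound\<^sup>2)) * exp (drift * \<sigma>\<^sup>2 * bet_bound\<^sup>2) \<and> \<bar>l \<omega>\<bar> \<le> bet_bound"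
      using AE_root_wealth_bounds[of n] AE_bet_bounds
    proof eventually_elim
      case (elim \<omega>)
      have l: "\<bar>l \<omega>\<bar> \<le> bet_bound" using elim by (simp add: l_def)
      then have "(l \<omega>)\<^sup>2 \<le> bet_bound\<^sup>2" using bet_bound_pos by (metis abs_le_square_iff abs_of_pos)
      then have e: "exp (drift * \<sigma>\<^sup>2 * (l \<omega>)\<^sup>2) \<le> exp (drift * \<sigma>\<^sup>2 * bet_bound\<^sup>2)" using drift_pos by (simp add: mult_left_mono)
      have "indicator A \<omega> * root_wealth n \<omega> \<le> sqrt (1 + bet_bound) ^ n * exp (drift * \<sigma>\<^sup>2 * (real n * bet_bound\<^sup>2))"
        using elim bet_bound_pos by (auto simp: indicator_def)
      then show ?case
        using elim l e bet_bound_pos unfolding W_def l_def[symmetric] by (auto intro!: mult_mono)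
    qed
  qed
  have int: "integrable M W" "integrable M (\<lambda>\<omega>. W \<omega> * l \<omega>)" "integrable M (\<lambda>\<omega>. W \<omega> * (l \<omega>)\<^sup>2)"
  proof -
    show "integrable M W"
      by (rule integrable_const_bound[of _ K]) (use K in auto)
    show "integrable M (\<lambda>\<omega>. W \<omega> * l \<omega>)"
    proof (rule integrable_const_bound[of _ "K * bet_bound"])
      show "AE \<omega> in M. norm (W \<omega> * l \<omega>) \<le> K * bet_bound"
        using K by eventually_elim (auto simp: abs_mult intro!: mult_mono)
    qed measurable
    show "integrable M (\<lambda>\<omega>. W \<omega> * (l \<omega>)\<^sup>2)"
    proof (rule integrable_const_bound[of _ "K * bet_bound\<^sup>2"])
      show "AE \<omega> in M. norm (W \<omega> * (l \<omega>)\<^sup>2) \<le> K * bet_bound\<^sup>2"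
        using K
      proof eventually_elim
        case (elim \<omega>)
        then have "(l \<omega>)\<^sup>2 \<le> bet_bound\<^sup>2" using bet_bound_pos by (metis abs_le_square_iff abs_of_pos)
        then show ?case using elim by (auto simp: abs_mult intro!: mult_mono)
      qed
    qed measurable
  qed
  have intY: "integrable M Y" "integrable M (\<lambda>\<omega>. (Y \<omega>)\<^sup>2)"
    unfolding Y_def by (auto intro!: X_integrable X_centered_sq_integrable)
  have ind1: "indep_var borel (\<lambda>\<omega>. W \<omega> * l \<omega>) borel Y"
    and ind2: "indep_var borel (\<lambda>\<omega>. W \<omega> * (l \<omega>)\<^sup>2) borel (\<lambda>\<omega>. (Y \<omega>)\<^sup>2)"
  proof -
    have "(\<lambda>\<omega>. W \<omega> * l \<omega>) \<in> borel_measurable (obs n)" using WF lF by measurable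
    from indep_var_compose[OF indep_var_sigma_gen_by_next[OF indep_X this], of "\<lambda>x. x" borel "\<lambda>x. x - m" borel]
    show "indep_var borel (\<lambda>\<omega>. W \<omega> * l \<omega>) borel Y" by (simp add: comp_def Y_def[abs_def])
    have "(\<lambda>\<omega>. W \<omega> * (l \<omega>)\<^sup>2) \<in> borel_measurable (obs n)" using WF lF by measurable
    from indep_var_compose[OF indep_var_sigma_gen_by_next[OF indep_X this], of "\<lambda>x. x" borel "\<lambda>x. (x - m)\<^sup>2" borel]
    show "indep_var borel (\<lambda>\<omega>. W \<omega> * (l \<omega>)\<^sup>2) borel (\<lambda>\<omega>. (Y \<omega>)\<^sup>2)"
      by (simp add: comp_def Y_def[abs_def])
  qed
  note intWY = indep_var_integrable[OF ind1 int(2) intY(1)] indep_var_integrable[OF ind2 int(3) intY(2)]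
  have "expectation (\<lambda>\<omega>. indicator A \<omega> * root_wealth (Suc n) \<omega>) \<le>
      expectation (\<lambda>\<omega>. W \<omega> + 1 / 2 * (W \<omega> * l \<omega> * Y \<omega>) - drift * (W \<omega> * (l \<omega>)\<^sup>2 * (Y \<omega>)\<^sup>2))"
  proof (rule integral_mono_AE)
    show "integrable M (\<lambda>\<omega>. indicator A \<omega> * root_wealth (Suc n) \<omega>)"
      using integrable_mult_indicator[OF _ root_wealth_integrable[of "Suc n"], of A] A obs_subalgebra[of n]
      by (auto simp: subalgebra_def)
    show "AE \<omega> in M. indicator A \<omega> * root_wealth (Suc n) \<omega> \<le>
        W \<omega> + 1 / 2 * (W \<omega> * l \<omega> * Y \<omega>) - drift * (W \<omega> * (l \<omega>)\<^sup>2 * (Y \<omega>)\<^sup>2)"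
      using K AE_bet_bounds
    proof eventually_elim
      case (elim \<omega>)
      have "sqrt (1 + l \<omega> * Y \<omega>) \<le> 1 + l \<omega> * Y \<omega> / 2 - (l \<omega> * Y \<omega>)\<^sup>2 / (2 * (2 + bet_bound)\<^sup>2)"
        using elim bet_bound_pos by (intro sqrt_one_plus_le) (auto simp: l_def Y_def)
      then have "W \<omega> * sqrt (1 + l \<omega> * Y \<omega>) \<le> W \<omega> * (1 + l \<omega> * Y \<omega> / 2 - drift * (l \<omega> * Y \<omega>)\<^sup>2)"
        using elim by (intro mult_left_mono) (auto simp: drift_def)
      moreover have "indicator A \<omega> * root_wealth (Suc n) \<omega> = W \<omega> * sqrt (1 + l \<omega> * Y \<omega>)"
        by (simp add: W_def root_wealth_Suc l_def Y_def)
      ultimately show ?case by (simp add: algebra_simps power_mult_distrib)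
    qed
  qed (use int intWY in auto)
  also have "\<dots> = expectation W + 1 / 2 * (expectation (\<lambda>\<omega>. W \<omega> * l \<omega>) * expectation Y)
      - drift * (expectation (\<lambda>\<omega>. W \<omega> * (l \<omega>)\<^sup>2) * expectation (\<lambda>\<omega>. (Y \<omega>)\<^sup>2))"
    using int intWY indep_var_lebesgue_integral[OF ind1 int(2) intY(1)]
      indep_var_lebesgue_integral[OF ind2 int(3) intY(2)] by simp
  also have "expectation Y = 0" unfolding Y_def by (rule X_centered_mean) simp
  also have "expectation (\<lambda>\<omega>. (Y \<omega>)\<^sup>2) = \<sigma>\<^sup>2" unfolding Y_def by (rule X_variance) simp
  also have "expectation W + 1 / 2 * (expectation (\<lambda>\<omega>. W \<omega> * l \<omega>) * 0) - drift * (expectation (\<lambda>\<omega>. W \<omega> * (l \<omega>)\<^sup>2) * \<sigma>\<^sup>2) =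
      expectation (\<lambda>\<omega>. W \<omega> - drift * \<sigma>\<^sup>2 * (W \<omega> * (l \<omega>)\<^sup>2))"
    using int by simp
  also have "\<dots> \<le> expectation (\<lambda>\<omega>. indicator A \<omega> * root_wealth n \<omega>)"
  proof (rule integral_mono_AE)
    show "integrable M (\<lambda>\<omega>. indicator A \<omega> * root_wealth n \<omega>)"
      using integrable_mult_indicator[OF _ root_wealth_integrable[of n], of A] A obs_subalgebra[of n]
      by (auto simp: subalgebra_def)
    show "AE \<omega> in M. W \<omega> - drift * \<sigma>\<^sup>2 * (W \<omega> * (l \<omega>)\<^sup>2) \<le> indicator A \<omega> * root_wealth n \<omega>"
      using AE_root_wealth_bounds[of n]
    proof eventually_elim
      case (elim \<omega>)
      \<comment> \<open>The compensator \<open>exp u\<close> is absorbed by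
        \<open>1 - u \<le> exp (- u)\<close>.\<close>
      define u where "u = drift * \<sigma>\<^sup>2 * (l \<omega>)\<^sup>2"
      have "exp u * (1 - u) \<le> exp u * exp (- u)"
        using exp_ge_add_one_self[of "- u"] by (intro mult_left_mono) auto
      then have "exp u * (1 - u) \<le> 1" by (simp flip: exp_add)
      then have "(indicator A \<omega> * root_wealth n \<omega>) * (exp u * (1 - u)) \<le> (indicator A \<omega> * root_wealth n \<omega>) * 1"
        using elim by (intro mult_left_mono) auto
      moreover have "W \<omega> - drift * \<sigma>\<^sup>2 * (W \<omega> * (l \<omega>)\<^sup>2) = (indicator A \<omega> * root_wealth n \<omega>) * (exp u * (1 - u))"
        unfolding W_def l_def[symmetric] u_def by (simp add: algebra_simps)
      ultimately show ?case by simp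
    qed
  qed (use int in auto)
  finally show ?thesis .
qed

text \<open>The square root of the wealth is the bounded \<open>root_wealth\<close> times an
  exponential of minus a positive multiple of the sum of squared bets, which diverges.\<close>

lemma wealth_tendsto_0: "AE \<omega> in M. (\<lambda>n. \<Prod>k = 1..n. (1 + lam k \<omega> * (X k \<omega> - m))) \<longlonglongrightarrow> 0"
proof -
  have "AE \<omega> in M. \<exists>C. \<forall>n. root_wealth n \<omega> \<le> C"
  proof (rule supermartingale_AE_bounded[of obs root_wealth, OF obs_subalgebra obs_mono[OF le_SucI[OF order.refl]]
        root_wealth_adapted root_wealth_integrable _ root_wealth_supermartingale])
    show "AE \<omega> in M. 0 \<le> root_wealth n \<omega>" for n using AE_root_wealth_bounds[of n] by eventually_elim simp
  qed
  moreover have "AE \<omega> in M. \<not> summable (\<lambda>k. (lam (Suc k) \<omega>)\<^sup>2)"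
    by (rule big_Omega_p_imp_not_summable_sq[OF _ big_Omega_p_lam_Suc]) simp
  ultimately show ?thesis using AE_bet_bounds
  proof eventually_elim
    case (elim \<omega>)
    then obtain C where C: "\<And>n. root_wealth n \<omega> \<le> C" by blast
    define R where "R n = (\<Prod>k=1..n. sqrt (1 + lam k \<omega> * (X k \<omega> - m)))" for n
    define Q where "Q n = (\<Sum>k=1..n. (lam k \<omega>)\<^sup>2)" for n
    have Q_eq: "Q n = (\<Sum>k<n. (lam (Suc k) \<omega>)\<^sup>2)" for n
      unfolding Q_def by (rule sum.reindex_bij_witness[of _ Suc "\<lambda>k. k - 1"]) auto
    \<comment> \<open>Partial sums of nonnegative terms that are not summable increase to
      infinity.\<close>
    have "filterlim Q at_top sequentially"
      unfolding filterlim_at_top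
    proof
      fix K
      have "\<exists>N. K < Q N"
      proof (rule ccontr)
        assume "\<not> (\<exists>N. K < Q N)"
        then have "(\<Sum>k<n. (lam (Suc k) \<omega>)\<^sup>2) \<le> K" for n by (simp add: Q_eq not_less)
        then have "summable (\<lambda>k. (lam (Suc k) \<omega>)\<^sup>2)" by (intro summableI_nonneg_bounded) auto
        then show False using elim(2) by contradiction
      qed
      then obtain N where N: "K < Q N" by blast
      have "Q N \<le> Q n" if "N \<le> n" for n
        using that unfolding Q_def by (intro sum_mono2) auto
      then show "\<forall>\<^sub>F n in sequentially. K \<le> Q n"
        using N by (intro eventually_sequentiallyI[of N]) (meson less_imp_le order.trans)
    qed
    then have "filterlim (\<lambda>n. drift * \<sigma>\<^sup>2 * Q n) at_top sequentially"
      using drift_pos \<sigma>_pos by (intro filterlim_tendsto_pos_mult_at_top[OF tendsto_const]) auto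
    then have "(\<lambda>n. C * exp (- (drift * \<sigma>\<^sup>2 * Q n))) \<longlonglongrightarrow> 0"
      by (intro tendsto_mult_right_zero filterlim_compose[OF exp_at_bot])
         (simp add: filterlim_uminus_at_bot)
    moreover have R0: "0 \<le> R n" for n
      unfolding R_def using elim by (intro prod_nonneg) auto
    have "norm (R n) \<le> C * exp (- (drift * \<sigma>\<^sup>2 * Q n))" for n
    proof -
      have "R n = root_wealth n \<omega> * exp (- (drift * \<sigma>\<^sup>2 * Q n))"
        unfolding root_wealth_def R_def Q_def by (simp add: mult.assoc flip: exp_add)
      also have "\<dots> \<le> C * exp (- (drift * \<sigma>\<^sup>2 * Q n))" by (intro mult_right_mono C) auto
      finally show ?thesis using R0[of n] by simp
    qed
    ultimately have "R \<longlonglongrightarrow> 0"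
      by (intro Lim_null_comparison[of R]) auto
    \<comment> \<open>Squaring recovers the wealth because all factors are nonnegative on this
      path.\<close>
    then have "(\<lambda>n. (R n)\<^sup>2) \<longlonglongrightarrow> 0" by (auto dest: tendsto_power[of _ _ _ 2])
    moreover have "(R n)\<^sup>2 = (\<Prod>k = 1..n. (1 + lam k \<omega> * (X k \<omega> - m)))" for n
      unfolding R_def prod_power_distrib using elim by (intro prod.cong) auto
    ultimately show ?case by simp
  qed
qed

end

theorem proposition2p6:
  fixes M :: "'a measure" and P :: "real measure"
    and X lam :: "nat \<Rightarrow> 'a \<Rightarrow> real" and m \<sigma> :: real
  assumes "prob_space M"
    and "prob_space P" and "sets P = sets borel" and "AE x in P. x \<in> {0..1}"
    and "m = (LINT x|P. x)"
    and "\<sigma>\<^sup>2 = (LINT x|P. (x - m)\<^sup>2)" and "\<sigma> > 0"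
    and "prob_space.indep_vars M (\<lambda>_. borel) X {1..}"
    and "\<And>k. k \<ge> 1 \<Longrightarrow> distr M borel (X k) = P"
    and "is_grapa M X m lam"
  shows "little_o_as M
           (\<lambda>n \<omega>. sqrt (real n) * lam (n + 1) \<omega>
                   - 1 / \<sigma>\<^sup>2 * ((\<Sum>k = 1..n. (X k \<omega> - m)) / sqrt (real n)))
           (\<lambda>n. real n powr (- 1 / 4) * ln (real n))
       \<and> weak_conv_m (\<lambda>n. distr M borel (\<lambda>\<omega>. sqrt (real n) * lam (n + 1) \<omega>))
           (density lborel (normal_density 0 (1 / \<sigma>)))
       \<and> big_Omega_p M lam (\<lambda>n. real n powr (- 1 / 2))
       \<and> (AE \<omega> in M. (\<lambda>n. \<Prod>k = 1..n. (1 + lam k \<omega> * (X k \<omega> - m))) \<longlonglongrightarrow> 0)"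
proof -
  have "grapa_model M P X lam m \<sigma>"
    by (rule grapa_model.intro[OF assms(1) grapa_model_axioms.intro[OF assms(3-10)]])
  then interpret grapa_model M P X lam m \<sigma> .
  show ?thesis
    by (rule conjI[OF bahadur_little_o conjI[OF asymptotic_normality conjI[OF big_Omega_p_lam wealth_tendsto_0]]])
qed

end
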